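(* Let $0<p<1$ and $0<s\le\infty$. Then $(H^{p,\infty},\ell^s)=\ell^s_{1/p-1}$.
   Context: $\mathbb{D}$ is the open unit disk, $\mathbb{T}$ its boundary, $m$ normalized Lebesgue measure on $\mathbb{T}$, $H(\mathbb{D})$ the analytic functions on $\mathbb{D}$. $W$ is the space of complex sequences indexed by $\mathbb{N}_0=\{0,1,2,\dots\}$; $f(z)=\sum a_nz^n\in H(\mathbb{D})$ is identified with $\{a_n\}\in W$. $\ell^s\subset W$ is the space of $s$-summable sequences ($s<\infty$) or bounded sequences ($s=\infty$). For vector subspaces $E,X$ of $W$, $(E,X)=\{\lambda\in W:\{\lambda_nw_n\}\in X\text{ for all }w\in E\}$. For real $\alpha$ let $w_\alpha(0)=1$, $w_\alpha(n)=n^\alpha$ for $n\ge1$, and $X_\alpha=\{y\in W:\{w_\alpha(n)y_n\}\in X\}$; $\ell^s_\alpha=(\ell^s)_\alpha$. $H^{p,\infty}$: for measurable $f$ on $\mathbb{T}$ let $\lambda_f(s)=m(\{|f|>s\})$, $f^*(s)=\inf\{t\ge0:\lambda_f(t)\le s\}$. The Smirnov class $N^+$ consists of $f\in H(\mathbb{D})$ in the Nevanlinna class with $\lim_{r\to1^-}\int_{\mathbb{T}}\log^+|f(rz)|\,dm=\int_{\mathbb{T}}\log^+|f|\,dm$, where $f$ on $\mathbb{T}$ is the nontangential boundary function. $H^{p,\infty}$ is the set of $f\in N^+$ with $\sup_{s>0}f^*(s)s^{1/p}<\infty$ for the boundary function. *)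

theory Defs
  imports "HOL-Probability.Probability" "HOL-Complex_Analysis.Complex_Analysis"
begin

section \<open>The unit circle and boundary values\<close>

text \<open>Normalized Lebesgue measure on the unit circle. It is completed, so that the measurable
  sets are the Lebesgue (not just the Borel) measurable subsets of the circle.\<close>

definition circle_measure :: "complex measure" where
  "circle_measure =
     completion (distr (uniform_measure lborel {0..2*pi}) (restrict_space borel (sphere 0 1)) cis)"

lemma space_circle_measure: "space circle_measure = sphere 0 1"
  by (simp add: circle_measure_def space_restrict_space)

lemma prob_space_circle_measure: "prob_space circle_measure"
proof -
  have u: "prob_space (uniform_measure lborel {0..2*pi})"
    by (rule prob_space_uniform_measure) auto
  have "cis \<in> borel_measurable borel"
    by (intro borel_measurable_continuous_onI continuous_on_cis continuous_on_id)
  hence "cis \<in> uniform_measure lborel {0..2*pi} \<rightarrow>\<^sub>M restrict_space borel (sphere 0 1)"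
    by (intro measurable_restrict_space2) auto
  from prob_space.prob_space_distr[OF u this] show ?thesis
    unfolding circle_measure_def by (rule prob_space.prob_space_completion)
qed

definition stolz_region :: "real \<Rightarrow> complex \<Rightarrow> complex set" where
  "stolz_region \<kappa> \<zeta> = {z \<in> ball 0 1. cmod (z - \<zeta>) < \<kappa> * (1 - cmod z)}"

definition has_nontangential_limit :: "(complex \<Rightarrow> complex) \<Rightarrow> complex \<Rightarrow> complex \<Rightarrow> bool" where
  "has_nontangential_limit f \<zeta> l \<longleftrightarrow> (\<forall>\<kappa>>1. (f \<longlongrightarrow> l) (at \<zeta> within stolz_region \<kappa> \<zeta>))"

text \<open>The value \<open>0\<close> where no nontangential limit exists is arbitrary: for functions in the
  Nevanlinna class this happens only on a null set.\<close>

definition boundary_function :: "(complex \<Rightarrow> complex) \<Rightarrow> complex \<Rightarrow> complex" where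
  "boundary_function f \<zeta> =
     (if \<exists>l. has_nontangential_limit f \<zeta> l then THE l. has_nontangential_limit f \<zeta> l else 0)"


section \<open>Nevanlinna class, Smirnov class, weak Hardy spaces\<close>

text \<open>Functions on the disk are represented by total functions on \<open>\<complex>\<close>; none of the notions
  below depends on their values outside the open disk.\<close>

definition log_plus :: "real \<Rightarrow> real" where
  "log_plus x = max 0 (ln x)"  \<comment> \<open>\<open>ln 0 = 0\<close>, hence \<open>log_plus 0 = 0\<close>\<close>

definition nevanlinna_class :: "(complex \<Rightarrow> complex) set" where
  "nevanlinna_class = {f. f holomorphic_on ball 0 1 \<and>
     (SUP r\<in>{0<..<1}. \<integral>\<^sup>+ \<zeta>. ennreal (log_plus (cmod (f (of_real r * \<zeta>)))) \<partial>circle_measure) < \<infinity>}"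

definition smirnov_class :: "(complex \<Rightarrow> complex) set" where
  "smirnov_class = {f \<in> nevanlinna_class.
     ((\<lambda>r. \<integral>\<^sup>+ \<zeta>. ennreal (log_plus (cmod (f (of_real r * \<zeta>)))) \<partial>circle_measure)
        \<longlongrightarrow> (\<integral>\<^sup>+ \<zeta>. ennreal (log_plus (cmod (boundary_function f \<zeta>))) \<partial>circle_measure)) (at_left 1)}"

definition distribution_function :: "(complex \<Rightarrow> complex) \<Rightarrow> real \<Rightarrow> real" where
  "distribution_function g s = measure circle_measure {\<zeta> \<in> sphere 0 1. cmod (g \<zeta>) > s}"

text \<open>Since \<open>circle_measure\<close> is finite, the set below is nonempty for measurable \<open>g\<close> and \<open>s > 0\<close>,
  so that the real-valued infimum is the intended one.\<close>

definition decreasing_rearrangement :: "(complex \<Rightarrow> complex) \<Rightarrow> real \<Rightarrow> real" where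
  "decreasing_rearrangement g s = Inf {t. 0 \<le> t \<and> distribution_function g t \<le> s}"

definition weak_hardy :: "real \<Rightarrow> (complex \<Rightarrow> complex) set" where
  "weak_hardy p = {f \<in> smirnov_class.
     bdd_above ((\<lambda>s. decreasing_rearrangement (boundary_function f) s * s powr (1/p)) ` {0<..})}"


section \<open>Sequence spaces and coefficient multipliers\<close>

definition taylor_sequences :: "(complex \<Rightarrow> complex) set \<Rightarrow> (nat \<Rightarrow> complex) set" where
  "taylor_sequences F = {a. \<exists>f\<in>F. \<forall>z\<in>ball 0 1. (\<lambda>n. a n * z ^ n) sums f z}"

definition ell :: "ennreal \<Rightarrow> (nat \<Rightarrow> complex) set" where
  "ell s = (if s = \<infinity> then {y. bounded (range y)}
            else {y. summable (\<lambda>n. cmod (y n) powr enn2real s)})"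

definition multipliers ::
  "(nat \<Rightarrow> complex) set \<Rightarrow> (nat \<Rightarrow> complex) set \<Rightarrow> (nat \<Rightarrow> complex) set" where
  "multipliers E X = {l. \<forall>w\<in>E. (\<lambda>n. l n * w n) \<in> X}"

definition weight :: "real \<Rightarrow> nat \<Rightarrow> real" where
  "weight \<alpha> n = (if n = 0 then 1 else real n powr \<alpha>)"

definition weighted :: "(nat \<Rightarrow> complex) set \<Rightarrow> real \<Rightarrow> (nat \<Rightarrow> complex) set" where
  "weighted X \<alpha> = {y. (\<lambda>n. of_real (weight \<alpha> n) * y n) \<in> X}"

end

theory Submission
  imports Defs
begin

text \<open>
  Write \<open>\<beta> = 1/p - 1\<close>. Both inclusions come from the exact growth of Taylor coefficients in the weak
  Hardy space: every \<open>f\<close> in it has coefficients of size \<open>O(n\<^sup>\<beta>)\<close>, and one single function,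
  \<open>(1 - z) powr (-1/p)\<close>, has positive coefficients of exactly this order. Given the upper bound
  (\<open>weak_hardy_coefficient_bound\<close>), a sequence in the weighted space multiplies every
  coefficient sequence into \<open>\<ell>\<^sup>s\<close>, since \<open>\<ell>\<^sup>s\<close> is solid. Conversely, a multiplier
  need only be tested on the coefficients of the extremal function
  (\<open>binomial_kernel_weak_hardy\<close>, \<open>weight_le_binomial_coefficient\<close>).

  The upper bound rests on \<open>\<integral> |f (r \<zeta>)| = O((1 - r) powr (-\<beta>))\<close>, to which Cauchy's formula on the circle
  of radius \<open>1 - 1/(n+1)\<close> is applied. For functions in \<open>H\<^sup>p\<close> such a mean bound is a classical theorem of
  Hardy and Littlewood; here is why it survives with only weak-type control of the boundary function \<open>f\<^sup>*\<close>.

  The Smirnov condition says that no mass of \<open>log\<^sup>+ |f|\<close> is lost at the boundary. Combined with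
  Fatou's lemma it gives \<open>log\<^sup>+ |f z| \<le> P[log\<^sup>+ |f\<^sup>*|] z\<close> with the Poisson integral \<open>P\<close>
  (\<open>smirnov_class_boundary\<close>). By Jensen's inequality
  \<open>|f z| powr (p/2) \<le> P[g] z\<close> for \<open>g = (max 1 |f\<^sup>*|) powr (p/2)\<close>, and the membership of \<open>f\<^sup>*\<close> in
  weak \<open>L\<^sup>p\<close> means that \<open>g\<close> is in weak \<open>L\<^sup>2\<close>. The exponent 2 is convenient: any exponent above 1
  makes \<open>g\<close> integrable and makes the Poisson integral act well. Convexity of \<open>x \<mapsto> max 0 (x - t)\<close> gives
  both that \<open>P[g]\<close> is at most a constant times \<open>(1 - r) powr (-1/2)\<close> on the circle of radius \<open>r\<close>
  (\<open>weak_L2_poisson_integral_sup\<close>) and that it is in weak \<open>L\<^sup>2\<close> there, uniformly in \<open>r\<close>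
  (\<open>weak_L2_poisson_integral\<close>). A function in weak \<open>L\<^sup>2\<close> with values in \<open>[0, A]\<close>, where \<open>A \<ge> 1\<close>, has
  \<open>\<integral> X powr a = O(A powr (a - 2))\<close> for \<open>a > 2\<close> (\<open>weak_L2_powr_bound\<close>); with \<open>a = 2/p\<close> and
  \<open>A\<close> of order \<open>(1 - r) powr (-1/2)\<close> this is the claimed rate.
\<close>

section \<open>Integration over the unit circle\<close>

lemma cis_measurable_uniform:
  "cis \<in> uniform_measure lborel {0..2*pi} \<rightarrow>\<^sub>M restrict_space borel (sphere 0 1)"
proof -
  have "cis \<in> borel_measurable borel"
    by (intro borel_measurable_continuous_onI continuous_on_cis continuous_on_id)
  thus ?thesis by (intro measurable_restrict_space2) auto
qed

lemma borel_measurable_circle: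
  assumes "g \<in> borel_measurable borel"
  shows "g \<in> borel_measurable circle_measure"
  unfolding circle_measure_def
  using assms by (intro measurable_completion) (simp add: measurable_restrict_space1)

lemma continuous_on_measurable_circle:
  fixes g :: "complex \<Rightarrow> 'b::topological_space"
  assumes "continuous_on (sphere 0 1) g"
  shows "g \<in> borel_measurable circle_measure"
  unfolding circle_measure_def
  using borel_measurable_continuous_on_restrict[OF assms]
  by (intro measurable_completion) simp

lemma ident_measurable_circle [measurable]: "(\<lambda>\<zeta>. \<zeta>) \<in> borel_measurable circle_measure"
  by (rule borel_measurable_circle) simp

interpretation circle: prob_space circle_measure
  by (rule prob_space_circle_measure)

lemma continuous_on_integrable_circle:
  fixes g :: "complex \<Rightarrow> 'b::{banach, second_countable_topology}"
  assumes "continuous_on (sphere 0 1) g"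
  shows "integrable circle_measure g"
proof -
  have "compact (g ` sphere 0 1)"
    by (intro compact_continuous_image assms) auto
  then obtain B where "\<And>x. x \<in> sphere 0 1 \<Longrightarrow> norm (g x) \<le> B"
    by (metis bounded_iff compact_imp_bounded image_eqI)
  thus ?thesis
    using continuous_on_measurable_circle[OF assms]
    by (intro circle.integrable_const_bound[where B = B]) (auto simp: space_circle_measure)
qed

text \<open>Arc length on the circle is \<open>d\<zeta> / (\<i> \<zeta>)\<close>; this is how the results on contour integrals become
  available for \<open>circle_measure\<close>.\<close>

lemma integral_circle_eq_contour_integral:
  assumes g: "continuous_on (sphere 0 1) g"
  shows "(\<integral>\<zeta>. g \<zeta> \<partial>circle_measure)
           = contour_integral (circlepath 0 1) (\<lambda>\<zeta>. g \<zeta> / \<zeta>) / (2 * pi * \<i>)"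
proof -
  let ?N = "restrict_space borel (sphere (0::complex) 1)"
  have gm: "g \<in> borel_measurable ?N"
    using g by (rule borel_measurable_continuous_on_restrict)
  have cg: "continuous_on S (\<lambda>t. g (cis t))" for S
    by (rule continuous_on_compose2[OF g]) (auto intro!: continuous_on_cis continuous_intros)
  have "(\<integral>\<zeta>. g \<zeta> \<partial>circle_measure) = (\<integral>t. g (cis t) \<partial>uniform_measure lborel {0..2*pi})"
    unfolding circle_measure_def
    by (subst integral_completion, use gm in simp)
       (rule integral_distr[OF cis_measurable_uniform gm])
  also have "\<dots> = (\<integral>t. (indicator {0..2*pi} t / (2*pi)) *\<^sub>R g (cis t) \<partial>lborel)"
  proof -
    have um: "uniform_measure lborel {0..2*pi}
        = density lborel (\<lambda>t. ennreal (indicator {0..2*pi} t / (2*pi)))"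
      unfolding uniform_measure_def
      by (intro arg_cong2[where f = density] refl ext)
         (auto simp: indicator_def ennreal_1[symmetric] divide_ennreal simp del: ennreal_1)
    show ?thesis
      unfolding um
      by (rule integral_density)
         (use borel_measurable_continuous_onI[OF cg] in \<open>auto simp: indicator_def\<close>)
  qed
  also have "\<dots> = (\<integral>t. (1/(2*pi)) *\<^sub>R (indicator {0..2*pi} t *\<^sub>R g (cis t)) \<partial>lborel)"
    by (intro Bochner_Integration.integral_cong refl) auto
  also have "\<dots> = (1/(2*pi)) *\<^sub>R (LINT t:{0..2*pi}|lborel. g (cis t))"
    unfolding set_lebesgue_integral_def by (rule integral_scaleR_right) 
  also have "(LINT t:{0..2*pi}|lborel. g (cis t)) = integral {0..2*pi} (\<lambda>t. g (cis t))"
    by (rule set_borel_integral_eq_integral(2))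
       (intro borel_integrable_atLeastAtMost' cg)
  also have "\<dots> = contour_integral (circlepath 0 1) (\<lambda>\<zeta>. g \<zeta> / \<zeta>) / \<i>"
  proof -
    have "contour_integral (part_circlepath 0 1 0 (2*pi)) (\<lambda>\<zeta>. g \<zeta> / \<zeta>)
        = integral {0..2*pi} (\<lambda>t. g (0 + of_real 1 * cis t) / (0 + of_real 1 * cis t) * of_real 1 * \<i> * cis t)"
      by (subst contour_integral_part_circlepath_eq) (auto)
    also have "\<dots> = integral {0..2*pi} (\<lambda>t. \<i> * g (cis t))"
      by (intro integral_cong) auto
    finally show ?thesis by (simp add: circlepath_def)
  qed
  finally show ?thesis
    by (simp add: scaleR_conv_of_real field_simps)
qed

section \<open>The Poisson kernel\<close>

definition poisson :: "complex \<Rightarrow> complex \<Rightarrow> real" where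
  "poisson z \<zeta> = (1 - (cmod z)\<^sup>2) / (cmod (\<zeta> - z))\<^sup>2"

lemma poisson_nonneg: "cmod z < 1 \<Longrightarrow> 0 \<le> poisson z \<zeta>"
  by (simp add: poisson_def power_le_one)

lemma continuous_on_poisson [continuous_intros]:
  assumes "cmod z < 1"
  shows "continuous_on (sphere 0 1) (poisson z)"
  unfolding poisson_def using assms by (intro continuous_intros) auto

lemma poisson_measurable [measurable]: "poisson z \<in> borel_measurable circle_measure"
  unfolding poisson_def by measurable

text \<open>On the circle \<open>1 - cnj z * \<zeta> = \<zeta> * cnj (\<zeta> - z)\<close>, which turns the Cauchy kernel times
  \<open>1 - |z|\<^sup>2\<close> into the Poisson kernel. So the formula is Cauchy's formula at \<open>z\<close> for the function
  \<open>h \<zeta> * (1 - |z|\<^sup>2) / (1 - cnj z * \<zeta>)\<close>, which agrees with \<open>h\<close> at \<open>z\<close>.\<close>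

lemma poisson_formula:
  assumes h: "continuous_on (cball 0 1) h" "h holomorphic_on ball 0 1" and z: "cmod z < 1"
  shows "(\<integral>\<zeta>. of_real (poisson z \<zeta>) * h \<zeta> \<partial>circle_measure) = h z"
proof -
  define k where "k = (\<lambda>\<zeta>. h \<zeta> * (of_real (1 - (cmod z)\<^sup>2) / (1 - cnj z * \<zeta>)))"
  have nz: "1 - cnj z * \<zeta> \<noteq> 0" if "cmod \<zeta> \<le> 1" for \<zeta>
  proof
    assume "1 - cnj z * \<zeta> = 0"
    hence "cmod (cnj z * \<zeta>) = 1" by simp
    moreover have "cmod (cnj z * \<zeta>) \<le> cmod z * 1"
      unfolding norm_mult using that by (intro mult_mono) auto
    ultimately show False using z by simp
  qed
  have sq: "z * cnj z = of_real ((cmod z)\<^sup>2)"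
    by (metis complex_norm_square)
  have "of_real (1 - (cmod z)\<^sup>2) = 1 - cnj z * z"
    using sq by (simp add: mult.commute)
  hence kz: "k z = h z"
    using nz[of z] z by (simp add: k_def)
  have contk: "continuous_on (cball 0 1) k" and holk: "k holomorphic_on ball 0 1"
    unfolding k_def using nz h
    by (auto intro!: continuous_intros holomorphic_intros simp: dist_norm)
  have "((\<lambda>u. k u / (u - z)) has_contour_integral 2 * of_real pi * \<i> * k z) (circlepath 0 1)"
    using z by (intro Cauchy_integral_circlepath contk holk) auto
  hence 1: "contour_integral (circlepath 0 1) (\<lambda>u. k u / (u - z)) = 2 * of_real pi * \<i> * h z"
    by (simp add: contour_integral_unique kz)
  have eq: "of_real (poisson z \<zeta>) * h \<zeta> / \<zeta> = k \<zeta> / (\<zeta> - z)" if "cmod \<zeta> = 1" for \<zeta>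
  proof -
    have "\<zeta> * cnj \<zeta> = 1" using that by (simp add: complex_norm_square[symmetric])
    hence a: "1 - cnj z * \<zeta> = \<zeta> * cnj (\<zeta> - z)" by (simp add: algebra_simps)
    have b: "of_real ((cmod (\<zeta> - z))\<^sup>2) = (\<zeta> - z) * cnj (\<zeta> - z)"
      by (rule complex_norm_square)
    show ?thesis
      unfolding poisson_def k_def a of_real_divide b by (simp add: mult_ac)
  qed
  have "continuous_on (sphere 0 1) (\<lambda>\<zeta>. of_real (poisson z \<zeta>) * h \<zeta>)"
    using z continuous_on_subset[OF h(1), of "sphere 0 1"] by (intro continuous_intros) auto
  hence "(\<integral>\<zeta>. of_real (poisson z \<zeta>) * h \<zeta> \<partial>circle_measure)
      = contour_integral (circlepath 0 1) (\<lambda>\<zeta>. of_real (poisson z \<zeta>) * h \<zeta> / \<zeta>) / (2 * pi * \<i>)"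
    by (rule integral_circle_eq_contour_integral)
  also have "contour_integral (circlepath 0 1) (\<lambda>\<zeta>. of_real (poisson z \<zeta>) * h \<zeta> / \<zeta>)
      = contour_integral (circlepath 0 1) (\<lambda>u. k u / (u - z))"
    by (rule contour_integral_cong) (auto simp: eq)
  finally show ?thesis by (simp add: 1)
qed

lemma integral_poisson: "cmod z < 1 \<Longrightarrow> (\<integral>\<zeta>. poisson z \<zeta> \<partial>circle_measure) = 1"
proof -
  assume z: "cmod z < 1"
  have "complex_of_real (\<integral>\<zeta>. poisson z \<zeta> \<partial>circle_measure) = 1"
    using poisson_formula[of "\<lambda>_. 1" z] z by simp
  thus ?thesis using of_real_eq_1_iff by blast
qed

lemma nn_integral_poisson:
  "cmod z < 1 \<Longrightarrow> (\<integral>\<^sup>+\<zeta>. ennreal (poisson z \<zeta>) \<partial>circle_measure) = 1"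
  by (subst nn_integral_eq_integral)
     (auto simp: integral_poisson poisson_nonneg continuous_on_integrable_circle continuous_on_poisson)

lemma poisson_le:
  assumes "cmod \<zeta> = 1" "cmod z < 1"
  shows "poisson z \<zeta> \<le> 2 / (1 - cmod z)"
proof -
  have "1 - cmod z \<le> cmod (\<zeta> - z)" using norm_triangle_ineq2[of \<zeta> z] assms by simp
  hence "poisson z \<zeta> \<le> (1 - (cmod z)\<^sup>2) / (1 - cmod z)\<^sup>2"
    unfolding poisson_def using assms
    by (intro divide_left_mono power_mono mult_pos_pos) (auto simp: power_le_one)
  also have "\<dots> = (1 + cmod z) / (1 - cmod z)"
  proof -
    have "1 - (cmod z)\<^sup>2 = (1 - cmod z) * (1 + cmod z)" by algebra
    thus ?thesis using assms by (simp add: power2_eq_square)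
  qed
  also have "\<dots> \<le> 2 / (1 - cmod z)"
    using assms by (intro divide_right_mono) auto
  finally show ?thesis .
qed

text \<open>Because of this symmetry, averaging a Poisson integral over a circle around \<open>0\<close> reduces to the
  total mass of the kernel.\<close>

lemma poisson_sym:
  assumes "cmod \<zeta> = 1" "cmod \<xi> = 1"
  shows "poisson (of_real r * \<xi>) \<zeta> = poisson (of_real r * \<zeta>) \<xi>"
proof -
  have "cmod (\<zeta> - of_real r * \<xi>) = cmod (\<xi> - of_real r * \<zeta>)"
  proof -
    have "(Re \<zeta>)\<^sup>2 + (Im \<zeta>)\<^sup>2 = 1" "(Re \<xi>)\<^sup>2 + (Im \<xi>)\<^sup>2 = 1"
      using assms by (simp_all add: cmod_def)
    hence "(Re \<zeta> - r * Re \<xi>)\<^sup>2 + (Im \<zeta> - r * Im \<xi>)\<^sup>2 = (Re \<xi> - r * Re \<zeta>)\<^sup>2 + (Im \<xi> - r * Im \<zeta>)\<^sup>2"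
      by algebra
    thus ?thesis by (simp add: cmod_def)
  qed
  thus ?thesis using assms by (simp add: poisson_def norm_mult)
qed

lemma integrable_poisson_mult:
  fixes g :: "complex \<Rightarrow> real"
  assumes g: "integrable circle_measure g" and z: "cmod z < 1"
  shows "integrable circle_measure (\<lambda>\<zeta>. poisson z \<zeta> * g \<zeta>)"
proof -
  define K where "K = 2 / (1 - cmod z)"
  have K: "K > 0" "\<And>\<zeta>. cmod \<zeta> = 1 \<Longrightarrow> poisson z \<zeta> \<le> K"
    using z poisson_le by (auto simp: K_def)
  show ?thesis
  proof (rule Bochner_Integration.integrable_bound[of _ "\<lambda>\<zeta>. K * g \<zeta>"])
    show "AE \<zeta> in circle_measure. norm (poisson z \<zeta> * g \<zeta>) \<le> norm (K * g \<zeta>)"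
      using K poisson_nonneg[OF z]
      by (intro AE_I2) (auto simp: abs_mult space_circle_measure intro!: mult_right_mono)
  qed (use g in auto)
qed

section \<open>Poisson majorants of analytic functions\<close>

text \<open>Since \<open>cnj \<zeta> = 1 / \<zeta>\<close> on the circle, \<open>A * cnj B\<close> is a trigonometric polynomial there, and
  conjugating its terms of negative frequency does not change the real part. In the induction step
  the two leading factors \<open>\<zeta>\<close> and \<open>cnj \<zeta>\<close> cancel.\<close>

lemma Re_mult_cnj_poly_on_circle:
  "\<exists>C. \<forall>\<zeta>\<in>sphere 0 1. Re (poly A \<zeta> * cnj (poly B \<zeta>)) = Re (poly C \<zeta>)"
proof (induction A arbitrary: B)
  case 0
  show ?case by (intro exI[of _ 0]) simp
next
  case (pCons a A)
  obtain b B' where B: "B = pCons b B'" by (cases B)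
  from pCons.IH[of B'] obtain C where
    C: "\<And>\<zeta>. \<zeta> \<in> sphere 0 1 \<Longrightarrow> Re (poly A \<zeta> * cnj (poly B' \<zeta>)) = Re (poly C \<zeta>)" by blast
  define D where "D = [:a * cnj b:] + smult (cnj a) (pCons 0 B') + smult (cnj b) (pCons 0 A) + C"
  have "Re (poly (pCons a A) \<zeta> * cnj (poly B \<zeta>)) = Re (poly D \<zeta>)" if z: "\<zeta> \<in> sphere 0 1" for \<zeta>
  proof -
    have "\<zeta> * cnj \<zeta> = 1" using z by (simp add: complex_norm_square[symmetric])
    hence "poly (pCons a A) \<zeta> * cnj (poly B \<zeta>) = a * cnj b + cnj (cnj a * (\<zeta> * poly B' \<zeta>))
        + cnj b * (\<zeta> * poly A \<zeta>) + poly A \<zeta> * cnj (poly B' \<zeta>)"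
      unfolding B poly_pCons complex_cnj_add complex_cnj_mult complex_cnj_cnj by algebra
    thus ?thesis by (simp only: D_def plus_complex.sel C[OF z] cnj.sel poly_add poly_smult poly_pCons) simp
  qed
  thus ?case by blast
qed

text \<open>Real parts of polynomials are closed under multiplication on the circle because
  \<open>2 * Re a * Re b = Re (a * b) + Re (a * cnj b)\<close>; so the Stone--Weierstrass theorem applies
  to them.\<close>

lemma Re_poly_dense_on_circle:
  assumes u: "continuous_on (sphere 0 1) u" and e: "e > 0"
  shows "\<exists>Q. \<forall>\<zeta>\<in>sphere 0 (1::real). \<bar>u \<zeta> - Re (poly Q \<zeta>)\<bar> < e"
proof -
  define R where "R = {v::complex \<Rightarrow> real. \<exists>Q. \<forall>\<zeta>\<in>sphere 0 1. v \<zeta> = Re (poly Q \<zeta>)}"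
  interpret function_ring_on R "sphere 0 1 :: complex set"
  proof
    show "compact (sphere 0 1 :: complex set)" by simp
  next
    fix f assume "f \<in> R"
    then obtain Q where Q: "\<And>\<zeta>. \<zeta> \<in> sphere 0 1 \<Longrightarrow> f \<zeta> = Re (poly Q \<zeta>)"
      by (auto simp: R_def)
    have "continuous_on (sphere 0 1) (\<lambda>\<zeta>. Re (poly Q \<zeta>))" by (intro continuous_intros)
    thus "continuous_on (sphere 0 1) f" by (subst continuous_on_cong[OF refl Q])
  next
    fix f g assume "f \<in> R" "g \<in> R"
    then obtain P Q where P: "\<And>\<zeta>. \<zeta> \<in> sphere 0 1 \<Longrightarrow> f \<zeta> = Re (poly P \<zeta>)"
        and Q: "\<And>\<zeta>. \<zeta> \<in> sphere 0 1 \<Longrightarrow> g \<zeta> = Re (poly Q \<zeta>)"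
      unfolding R_def by blast
    show "(\<lambda>x. f x + g x) \<in> R"
      unfolding R_def using P Q by (auto intro!: exI[of _ "P + Q"])
    obtain C where C: "\<And>\<zeta>. \<zeta> \<in> sphere 0 1 \<Longrightarrow> Re (poly P \<zeta> * cnj (poly Q \<zeta>)) = Re (poly C \<zeta>)"
      using Re_mult_cnj_poly_on_circle by blast
    have "f \<zeta> * g \<zeta> = Re (poly (smult (1/2) (P * Q + C)) \<zeta>)" if "\<zeta> \<in> sphere 0 1" for \<zeta>
      using P[OF that] Q[OF that] C[OF that] by simp
    thus "(\<lambda>x. f x * g x) \<in> R" unfolding R_def by blast
  next
    fix c show "(\<lambda>_. c) \<in> R"
      unfolding R_def by (auto intro!: exI[of _ "[:of_real c:]"])
  next
    fix x y :: complex assume "x \<noteq> y"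
    have "Re \<in> R" unfolding R_def by (auto intro!: exI[of _ "[:0, 1:]"])
    moreover have "Im \<in> R" unfolding R_def by (auto intro!: exI[of _ "[:0, -\<i>:]"])
    ultimately show "\<exists>f\<in>R. f x \<noteq> f y" using \<open>x \<noteq> y\<close> complex_eqI by blast
  qed
  from Stone_Weierstrass_basic[OF u e] obtain g where "g \<in> R" "\<forall>x\<in>sphere 0 1. \<bar>u x - g x\<bar> < e" by blast
  thus ?thesis unfolding R_def by fastforce
qed

text \<open>If \<open>u\<close> is the real part of a polynomial \<open>Q\<close>, this is the maximum principle for \<open>f * exp (- Q)\<close>
  together with the Poisson formula for \<open>Q\<close>. A general \<open>u\<close> is approximated from above by such real
  parts.\<close>

lemma norm_le_exp_poisson:
  assumes f: "continuous_on (cball 0 1) f" "f holomorphic_on ball 0 1"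
    and u: "continuous_on (sphere 0 1) u" and le: "\<And>\<zeta>. cmod \<zeta> = 1 \<Longrightarrow> cmod (f \<zeta>) \<le> exp (u \<zeta>)"
    and z: "cmod z < 1"
  shows "cmod (f z) \<le> exp (\<integral>\<zeta>. poisson z \<zeta> * u \<zeta> \<partial>circle_measure)"
proof (cases "f z = 0")
  case False
  define I where "I = (\<integral>\<zeta>. poisson z \<zeta> * u \<zeta> \<partial>circle_measure)"
  have intu: "integrable circle_measure (\<lambda>\<zeta>. poisson z \<zeta> * u \<zeta>)"
    using z u by (intro continuous_on_integrable_circle continuous_intros)
  have intP: "integrable circle_measure (poisson z)"
    using z by (intro continuous_on_integrable_circle continuous_intros)
  have "ln (cmod (f z)) \<le> I + e" if e: "e > 0" for e
  proof -
    have "continuous_on (sphere 0 1) (\<lambda>\<zeta>. u \<zeta> + e / 2)" by (intro continuous_intros u)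
    \<comment> \<open>The shift by \<open>e/2\<close> makes the approximation lie above \<open>u\<close>.\<close>
    from Re_poly_dense_on_circle[OF this, of "e/2"] e obtain Q
      where "\<forall>\<zeta>\<in>sphere 0 1. \<bar>u \<zeta> + e/2 - Re (poly Q \<zeta>)\<bar> < e/2" by auto
    hence Q: "\<bar>u \<zeta> + e/2 - Re (poly Q \<zeta>)\<bar> < e/2" if "cmod \<zeta> = 1" for \<zeta>
      using that by simp
    have "cmod (f z * exp (- poly Q z)) \<le> 1"
    proof (rule maximum_modulus_frontier[where S = "cball 0 1" and f = "\<lambda>\<zeta>. f \<zeta> * exp (- poly Q \<zeta>)"])
      show "(\<lambda>\<zeta>. f \<zeta> * exp (- poly Q \<zeta>)) holomorphic_on interior (cball 0 1)"
        using f by (auto intro!: holomorphic_intros)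
      show "continuous_on (closure (cball 0 1)) (\<lambda>\<zeta>. f \<zeta> * exp (- poly Q \<zeta>))"
        using f by (auto intro!: continuous_intros)
      fix \<zeta> :: complex assume "\<zeta> \<in> frontier (cball 0 1)"
      hence 1: "cmod \<zeta> = 1" by (simp add: frontier_cball)
      have "cmod (f \<zeta> * exp (- poly Q \<zeta>)) \<le> exp (u \<zeta>) * exp (- Re (poly Q \<zeta>))"
        by (simp add: norm_mult le[OF 1])
      also have "\<dots> = exp (u \<zeta> - Re (poly Q \<zeta>))" by (simp add: exp_diff exp_minus field_simps)
      also have "\<dots> \<le> 1" using Q[OF 1] unfolding abs_less_iff by simp
      finally show "cmod (f \<zeta> * exp (- poly Q \<zeta>)) \<le> 1" .
    qed (use z in auto)
    hence "cmod (f z) \<le> exp (Re (poly Q z))"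
      by (simp add: norm_mult norm_divide exp_minus field_simps)
    hence "ln (cmod (f z)) \<le> Re (poly Q z)"
      using False by (metis ln_exp ln_le_cancel_iff exp_gt_zero zero_less_norm_iff)
    also have "poly Q z = (\<integral>\<zeta>. of_real (poisson z \<zeta>) * poly Q \<zeta> \<partial>circle_measure)"
      by (rule poisson_formula[symmetric]) (auto intro!: continuous_intros holomorphic_intros z)
    also have "Re \<dots> = (\<integral>\<zeta>. Re (of_real (poisson z \<zeta>) * poly Q \<zeta>) \<partial>circle_measure)"
      by (rule integral_Re[symmetric], rule continuous_on_integrable_circle)
         (intro continuous_intros z)
    also have "\<dots> \<le> (\<integral>\<zeta>. poisson z \<zeta> * u \<zeta> + e * poisson z \<zeta> \<partial>circle_measure)"
    proof (rule integral_mono)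
      show "integrable circle_measure (\<lambda>\<zeta>. Re (of_real (poisson z \<zeta>) * poly Q \<zeta>))"
        by (intro continuous_on_integrable_circle continuous_intros z)
      show "integrable circle_measure (\<lambda>\<zeta>. poisson z \<zeta> * u \<zeta> + e * poisson z \<zeta>)"
        by (intro continuous_on_integrable_circle continuous_intros z u)
      fix \<zeta> assume "\<zeta> \<in> space circle_measure"
      hence "cmod \<zeta> = 1" by (simp add: space_circle_measure)
      hence "Re (poly Q \<zeta>) \<le> u \<zeta> + e" using Q[of \<zeta>] unfolding abs_less_iff by simp
      from mult_left_mono[OF this poisson_nonneg[OF z]]
      show "Re (of_real (poisson z \<zeta>) * poly Q \<zeta>) \<le> poisson z \<zeta> * u \<zeta> + e * poisson z \<zeta>"
        by (simp add: algebra_simps)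
    qed
    also have "\<dots> = I + e"
      using intu intP by (simp add: I_def integral_poisson[OF z])
    finally show ?thesis .
  qed
  hence "ln (cmod (f z)) \<le> I" by (rule field_le_epsilon)
  thus ?thesis using False unfolding I_def by (metis exp_ln exp_le_cancel_iff zero_less_norm_iff)
qed simp

lemma log_plus_nonneg [simp]: "0 \<le> log_plus x"
  by (simp add: log_plus_def)

lemma log_plus_eq: "0 \<le> x \<Longrightarrow> log_plus x = ln (max 1 x)"
  by (cases "x = 0") (auto simp: log_plus_def max_def)

lemma exp_log_plus: "0 \<le> x \<Longrightarrow> exp (log_plus x) = max 1 x"
  by (simp add: log_plus_eq)

lemma continuous_on_log_plus_norm [continuous_intros]:
  "continuous_on S f \<Longrightarrow> continuous_on S (\<lambda>x. log_plus (norm (f x)))"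
  by (simp add: log_plus_eq) (intro continuous_intros, auto)

lemma log_plus_measurable [measurable]: "log_plus \<in> borel_measurable borel"
  unfolding log_plus_def by measurable

text \<open>The case \<open>u = log\<^sup>+ |f|\<close>: the positive part makes \<open>u\<close> continuous also where \<open>f\<close> vanishes on the
  circle.\<close>

lemma log_plus_le_poisson:
  assumes f: "continuous_on (cball 0 1) f" "f holomorphic_on ball 0 1" and z: "cmod z < 1"
  shows "log_plus (cmod (f z)) \<le> (\<integral>\<zeta>. poisson z \<zeta> * log_plus (cmod (f \<zeta>)) \<partial>circle_measure)"
proof -
  let ?I = "\<integral>\<zeta>. poisson z \<zeta> * log_plus (cmod (f \<zeta>)) \<partial>circle_measure"
  have "cmod (f z) \<le> exp ?I"
  proof (rule norm_le_exp_poisson[OF f _ _ z])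
    show "continuous_on (sphere 0 1) (\<lambda>\<zeta>. log_plus (cmod (f \<zeta>)))"
      by (intro continuous_intros continuous_on_subset[OF f(1)]) auto
  qed (simp add: exp_log_plus)
  moreover have "0 \<le> ?I"
    using poisson_nonneg[OF z] by (intro integral_nonneg_AE) auto
  ultimately have "max 1 (cmod (f z)) \<le> exp ?I" by simp
  thus ?thesis by (metis exp_log_plus exp_le_cancel_iff norm_ge_zero)
qed

section \<open>Boundary functions\<close>

lemma radius_in_stolz_region:
  assumes "cmod \<zeta> = 1" "\<kappa> > 1" "0 < r" "r < 1"
  shows "of_real r * \<zeta> \<in> stolz_region \<kappa> \<zeta>"
proof -
  have "of_real r * \<zeta> - \<zeta> = of_real (r - 1) * \<zeta>" by (simp add: algebra_simps)
  hence "cmod (of_real r * \<zeta> - \<zeta>) = 1 - r"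
    using assms by (simp only: norm_mult norm_of_real) simp
  moreover have "1 - r < \<kappa> * (1 - r)" using assms by simp
  ultimately show ?thesis
    using assms by (simp add: stolz_region_def norm_mult)
qed

lemma stolz_region_mono: "\<kappa> \<le> \<kappa>' \<Longrightarrow> stolz_region \<kappa> \<zeta> \<subseteq> stolz_region \<kappa>' \<zeta>"
  unfolding stolz_region_def
  by (auto intro: less_le_trans mult_right_mono)

lemma has_nontangential_limit_radial:
  assumes lim: "has_nontangential_limit f \<zeta> l" and \<zeta>: "cmod \<zeta> = 1"
  shows "((\<lambda>r. f (of_real r * \<zeta>)) \<longlongrightarrow> l) (at_left 1)"
proof -
  have "eventually (\<lambda>r::real. r \<in> {0<..<1}) (at_left 1)"
    by (rule eventually_at_left_real) simp
  hence "eventually (\<lambda>r. of_real r * \<zeta> \<in> stolz_region 2 \<zeta> \<and> of_real r * \<zeta> \<noteq> \<zeta>) (at_left 1)"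
    by eventually_elim (use \<zeta> radius_in_stolz_region[OF \<zeta>, of 2] in auto)
  moreover have "((\<lambda>r. of_real r * \<zeta>) \<longlongrightarrow> of_real 1 * \<zeta>) (at_left 1)"
    by (intro tendsto_intros)
  ultimately have "filterlim (\<lambda>r. of_real r * \<zeta>) (at \<zeta> within stolz_region 2 \<zeta>) (at_left 1)"
    by (simp add: filterlim_at)
  moreover have "(f \<longlongrightarrow> l) (at \<zeta> within stolz_region 2 \<zeta>)"
    using lim by (simp add: has_nontangential_limit_def)
  ultimately show ?thesis by (rule filterlim_compose[rotated])
qed

lemma boundary_function_eq:
  assumes "has_nontangential_limit f \<zeta> l" "cmod \<zeta> = 1"
  shows "boundary_function f \<zeta> = l"
proof -
  have "l' = l" if "has_nontangential_limit f \<zeta> l'" for l'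
    using has_nontangential_limit_radial[OF that assms(2)] has_nontangential_limit_radial[OF assms]
    by (rule tendsto_unique[rotated]) simp
  with assms(1) have "(THE l. has_nontangential_limit f \<zeta> l) = l" by blast
  thus ?thesis using assms(1) by (auto simp: boundary_function_def)
qed

definition radius_seq :: "nat \<Rightarrow> real" where "radius_seq n = 1 - 1 / (real n + 2)"

lemma radius_seq: "0 < radius_seq n" "radius_seq n < 1"
  by (auto simp: radius_seq_def field_simps)

lemma radius_seq_at_left: "filterlim radius_seq (at_left 1) sequentially"
proof -
  have "radius_seq \<longlonglongrightarrow> 1" unfolding radius_seq_def by real_asymp
  thus ?thesis by (auto simp: filterlim_at radius_seq intro!: always_eventually)
       (metis less_irrefl radius_seq(2))
qed

lemma radius_seq_tendsto: "(\<lambda>n. of_real (radius_seq n) * \<zeta>) \<longlonglongrightarrow> (\<zeta>::complex)"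
proof -
  have "radius_seq \<longlonglongrightarrow> 1" unfolding radius_seq_def by real_asymp
  hence "(\<lambda>n. of_real (radius_seq n) * \<zeta>) \<longlonglongrightarrow> of_real 1 * \<zeta>" by (intro tendsto_intros)
  thus ?thesis by simp
qed

text \<open>The Cauchy criterion for a nontangential limit at \<open>\<zeta>\<close> in terms of sets that are closed in \<open>\<zeta>\<close>: the
  condition that a fixed \<open>z\<close> belongs to the approach region of \<open>\<zeta>\<close> is open in \<open>\<zeta>\<close>. It shows that the
  points with a nontangential limit form a Borel set, hence that the boundary function is measurable.\<close>

definition small_oscillation :: "(complex \<Rightarrow> complex) \<Rightarrow> real \<Rightarrow> real \<Rightarrow> real \<Rightarrow> complex set" where
  "small_oscillation f \<kappa> \<delta> e = {\<zeta>. \<forall>z w. z \<in> stolz_region \<kappa> \<zeta> \<and> w \<in> stolz_region \<kappa> \<zeta> \<and>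
     dist z \<zeta> < \<delta> \<and> dist w \<zeta> < \<delta> \<longrightarrow> dist (f z) (f w) \<le> e}"

lemma closed_small_oscillation: "closed (small_oscillation f \<kappa> \<delta> e)"
proof -
  have "- small_oscillation f \<kappa> \<delta> e = (\<Union>z\<in>ball 0 1. \<Union>w\<in>{w\<in>ball 0 1. dist (f z) (f w) > e}.
      ball z (\<kappa> * (1 - cmod z)) \<inter> ball w (\<kappa> * (1 - cmod w)) \<inter> ball z \<delta> \<inter> ball w \<delta>)"
    unfolding small_oscillation_def stolz_region_def
    by (rule set_eqI) (simp add: dist_norm not_le Bex_def, blast)
  also have "open \<dots>" by (intro open_UN ballI open_Int open_ball)
  finally show ?thesis by (simp add: closed_def)
qed

lemma ex_nontangential_limit_iff:
  assumes \<zeta>: "cmod \<zeta> = 1"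
  shows "(\<exists>l. has_nontangential_limit f \<zeta> l) \<longleftrightarrow>
     (\<forall>k j::nat. \<exists>i::nat. \<zeta> \<in> small_oscillation f (real k + 2) (1 / Suc i) (1 / Suc j))"
proof safe
  fix l and k j :: nat
  assume "has_nontangential_limit f \<zeta> l"
  hence "(f \<longlongrightarrow> l) (at \<zeta> within stolz_region (real k + 2) \<zeta>)"
    by (simp add: has_nontangential_limit_def)
  moreover have "(1 / Suc j) / 2 > 0" by simp
  ultimately obtain d where d: "d > 0"
      "\<And>z. z \<in> stolz_region (real k + 2) \<zeta> \<Longrightarrow> z \<noteq> \<zeta> \<Longrightarrow> dist z \<zeta> < d \<Longrightarrow> dist (f z) l < (1 / Suc j) / 2"
    unfolding tendsto_iff eventually_at by (metis)
  obtain i where i: "1 / Suc i < d"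
    using d(1) by (metis nat_approx_posE)
  have "dist (f z) (f w) \<le> 1 / Suc j"
    if "z \<in> stolz_region (real k + 2) \<zeta>" "w \<in> stolz_region (real k + 2) \<zeta>"
       "dist z \<zeta> < 1 / Suc i" "dist w \<zeta> < 1 / Suc i" for z w
  proof -
    have "z \<noteq> \<zeta>" "w \<noteq> \<zeta>" using that \<zeta> by (auto simp: stolz_region_def)
    hence "dist (f z) l < (1 / Suc j) / 2" "dist (f w) l < (1 / Suc j) / 2"
      using d(2)[of z] d(2)[of w] that i by linarith+
    thus ?thesis using dist_triangle_half_r[of l "f z" "1 / Suc j" "f w"] by (simp add: dist_commute)
  qed
  thus "\<exists>i::nat. \<zeta> \<in> small_oscillation f (real k + 2) (1 / Suc i) (1 / Suc j)"
    unfolding small_oscillation_def by blast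
next
  assume osc: "\<forall>k j::nat. \<exists>i::nat. \<zeta> \<in> small_oscillation f (real k + 2) (1 / Suc i) (1 / Suc j)"
  define x where "x = (\<lambda>n. of_real (radius_seq n) * \<zeta>)"
  have x_in: "x n \<in> stolz_region \<kappa> \<zeta>" if "\<kappa> > 1" for n \<kappa>
    unfolding x_def using \<zeta> that radius_seq by (intro radius_in_stolz_region) auto
  have x_lim: "x \<longlonglongrightarrow> \<zeta>" unfolding x_def by (rule radius_seq_tendsto)
  have close: "\<exists>\<delta>>0. \<forall>z w. z \<in> stolz_region \<kappa> \<zeta> \<and> w \<in> stolz_region \<kappa> \<zeta> \<and>
     dist z \<zeta> < \<delta> \<and> dist w \<zeta> < \<delta> \<longrightarrow> dist (f z) (f w) < e" if e: "e > 0" for \<kappa> e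
  proof -
    obtain j where j: "1 / Suc j < e" using e by (metis nat_approx_posE)
    obtain k :: nat where k: "\<kappa> \<le> real k" using real_arch_simple by blast
    obtain i where "\<zeta> \<in> small_oscillation f (real k + 2) (1 / Suc i) (1 / Suc j)" using osc by blast
    thus ?thesis
      unfolding small_oscillation_def
      using j k stolz_region_mono[of \<kappa> "real k + 2" \<zeta>]
      by (intro exI[of _ "1 / Suc i"]) fastforce
  qed
  have "Cauchy (\<lambda>n. f (x n))"
  proof (rule metric_CauchyI)
    fix e :: real assume "e > 0"
    from close[OF this, of 2] obtain \<delta> where \<delta>: "\<delta> > 0"
      "\<And>z w. z \<in> stolz_region 2 \<zeta> \<Longrightarrow> w \<in> stolz_region 2 \<zeta> \<Longrightarrow>
         dist z \<zeta> < \<delta> \<Longrightarrow> dist w \<zeta> < \<delta> \<Longrightarrow> dist (f z) (f w) < e" by blast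
    from x_lim \<delta>(1) obtain M where "\<And>n. n \<ge> M \<Longrightarrow> dist (x n) \<zeta> < \<delta>"
      unfolding lim_sequentially by blast
    thus "\<exists>M. \<forall>m\<ge>M. \<forall>n\<ge>M. dist (f (x m)) (f (x n)) < e"
      using \<delta>(2) x_in[of 2] by (intro exI[of _ M]) simp
  qed
  then obtain l where l: "(\<lambda>n. f (x n)) \<longlonglongrightarrow> l"
    using Cauchy_convergent convergent_def by blast
  have "(f \<longlongrightarrow> l) (at \<zeta> within stolz_region \<kappa> \<zeta>)" if \<kappa>: "\<kappa> > 1" for \<kappa>
  proof (rule tendstoI)
    fix e :: real assume "e > 0"
    from close[of "e/2" \<kappa>] this obtain \<delta> where \<delta>: "\<delta> > 0"
      "\<And>z w. z \<in> stolz_region \<kappa> \<zeta> \<Longrightarrow> w \<in> stolz_region \<kappa> \<zeta> \<Longrightarrow>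
         dist z \<zeta> < \<delta> \<Longrightarrow> dist w \<zeta> < \<delta> \<Longrightarrow> dist (f z) (f w) < e/2" by auto
    have "dist (f z) l < e" if z: "z \<in> stolz_region \<kappa> \<zeta>" "dist z \<zeta> < \<delta>" for z
    proof -
      have "eventually (\<lambda>n. dist (x n) \<zeta> < \<delta>) sequentially"
        using x_lim \<delta>(1) by (rule tendstoD)
      hence "eventually (\<lambda>n. dist (f z) (f (x n)) \<le> e/2) sequentially"
        by eventually_elim (use \<delta>(2) z x_in[OF \<kappa>] in \<open>auto intro: less_imp_le\<close>)
      moreover have "(\<lambda>n. dist (f z) (f (x n))) \<longlonglongrightarrow> dist (f z) l"
        by (intro tendsto_intros l)
      ultimately have "dist (f z) l \<le> e/2"
        by (intro tendsto_upperbound) auto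
      thus ?thesis using \<open>e > 0\<close> by simp
    qed
    thus "eventually (\<lambda>z. dist (f z) l < e) (at \<zeta> within stolz_region \<kappa> \<zeta>)"
      unfolding eventually_at using \<delta>(1) by blast
  qed
  thus "\<exists>l. has_nontangential_limit f \<zeta> l"
    unfolding has_nontangential_limit_def by blast
qed

lemma borel_sets_circle: "A \<in> sets borel \<Longrightarrow> A \<inter> sphere 0 1 \<in> sets circle_measure"
  using measurable_sets[OF ident_measurable_circle, of A] by (simp add: space_circle_measure)

lemma continuous_on_dilation:
  assumes "f holomorphic_on ball 0 (1::real)" "0 < r" "r < 1"
  shows "continuous_on (cball 0 1) (\<lambda>\<zeta>. f (of_real r * \<zeta>))"
    and "(\<lambda>\<zeta>. f (of_real r * \<zeta>)) holomorphic_on ball 0 1"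
proof -
  have 1: "of_real r * \<zeta> \<in> ball 0 1" if "\<zeta> \<in> cball 0 1" for \<zeta> :: complex
  proof -
    have "r * cmod \<zeta> \<le> r * 1" using that assms by (intro mult_left_mono) auto
    hence "r * cmod \<zeta> < 1" using assms(3) by linarith
    thus ?thesis using assms(2) by (simp add: norm_mult)
  qed
  show "continuous_on (cball 0 1) (\<lambda>\<zeta>. f (of_real r * \<zeta>))"
    by (rule continuous_on_compose2[OF holomorphic_on_imp_continuous_on[OF assms(1)]])
       (use 1 in \<open>auto intro!: continuous_intros\<close>)
  have "(f \<circ> (\<lambda>\<zeta>. of_real r * \<zeta>)) holomorphic_on ball 0 1"
    by (rule holomorphic_on_compose_gen[OF _ assms(1)])
       (use 1 in \<open>auto intro!: holomorphic_intros\<close>)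
  thus "(\<lambda>\<zeta>. f (of_real r * \<zeta>)) holomorphic_on ball 0 1" by (simp add: o_def)
qed

lemma boundary_function_measurable:
  assumes f: "f holomorphic_on ball 0 (1::real)"
  shows "boundary_function f \<in> borel_measurable circle_measure"
proof -
  define E where "E = (\<Inter>k j::nat. \<Union>i::nat. small_oscillation f (real k + 2) (1 / Suc i) (1 / Suc j)) \<inter> sphere 0 1"
  have E: "E \<in> sets circle_measure"
    unfolding E_def using closed_small_oscillation
    by (intro borel_sets_circle sets.countable_INT'' sets.countable_UN') (auto intro: borel_closed)
  have "(\<lambda>\<zeta>. if \<zeta> \<in> E then lim (\<lambda>n. f (of_real (radius_seq n) * \<zeta>)) else 0) \<in> borel_measurable circle_measure"
  proof (intro measurable_If_set borel_measurable_lim_metric)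
    show "(\<lambda>\<zeta>. f (of_real (radius_seq n) * \<zeta>)) \<in> borel_measurable circle_measure" for n
      using continuous_on_dilation(1)[OF f radius_seq, of n]
      by (intro continuous_on_measurable_circle) (rule continuous_on_subset, auto)
  qed (use E in \<open>auto simp: space_circle_measure E_def\<close>)
  moreover have "boundary_function f \<zeta> = (if \<zeta> \<in> E then lim (\<lambda>n. f (of_real (radius_seq n) * \<zeta>)) else 0)"
    if "\<zeta> \<in> space circle_measure" for \<zeta>
  proof -
    have \<zeta>: "cmod \<zeta> = 1" using that by (simp add: space_circle_measure)
    have iff: "\<zeta> \<in> E \<longleftrightarrow> (\<exists>l. has_nontangential_limit f \<zeta> l)"
      unfolding ex_nontangential_limit_iff[OF \<zeta>] E_def using \<zeta> by auto
    show ?thesis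
    proof (cases "\<zeta> \<in> E")
      case True
      then obtain l where l: "has_nontangential_limit f \<zeta> l" using iff by blast
      from filterlim_compose[OF has_nontangential_limit_radial[OF l \<zeta>] radius_seq_at_left]
      show ?thesis using True boundary_function_eq[OF l \<zeta>] by (simp add: limI)
    next
      case False
      thus ?thesis using iff by (simp add: boundary_function_def)
    qed
  qed
  ultimately show ?thesis by (subst measurable_cong)
qed

text \<open>Let \<open>u n\<close> be \<open>log\<^sup>+ |f|\<close> on the circle of radius \<open>r n = radius_seq n\<close>, and \<open>G\<close> the same for
  the boundary function. The Poisson kernel at \<open>z\<close> is at most a constant \<open>K\<close>, and the Smirnov condition
  says \<open>\<integral> K * u n \<longlonglongrightarrow> \<integral> K * G\<close>. Fatou's lemma for the nonnegative functions \<open>(K - P) * u n\<close> bounds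
  \<open>\<integral> (K - P) * G\<close> from above, so that what remains, \<open>\<integral> P * G\<close>, is bounded from below by the
  limit of \<open>log\<^sup>+ |f (r n * z)| \<le> \<integral> P * u n\<close>. The pointwise inequality \<open>G \<le> liminf (u n)\<close> is an
  equality where there is a nontangential limit, and elsewhere \<open>G\<close> is \<open>0\<close>.\<close>

lemma smirnov_class_boundary:
  assumes f: "f \<in> smirnov_class"
  shows "integrable circle_measure (\<lambda>\<zeta>. log_plus (cmod (boundary_function f \<zeta>)))"
    and "cmod z < 1 \<Longrightarrow> log_plus (cmod (f z))
           \<le> (\<integral>\<zeta>. poisson z \<zeta> * log_plus (cmod (boundary_function f \<zeta>)) \<partial>circle_measure)"
proof -
  have hol: "f holomorphic_on ball 0 1"
    and nev: "(SUP r\<in>{0<..<1}. \<integral>\<^sup>+ \<zeta>. ennreal (log_plus (cmod (f (of_real r * \<zeta>)))) \<partial>circle_measure) < \<infinity>"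
    and lim: "((\<lambda>r. \<integral>\<^sup>+ \<zeta>. ennreal (log_plus (cmod (f (of_real r * \<zeta>)))) \<partial>circle_measure)
        \<longlongrightarrow> (\<integral>\<^sup>+ \<zeta>. ennreal (log_plus (cmod (boundary_function f \<zeta>))) \<partial>circle_measure)) (at_left 1)"
    using f by (auto simp: smirnov_class_def nevanlinna_class_def)
  define u where "u = (\<lambda>n \<zeta>. log_plus (cmod (f (of_real (radius_seq n) * \<zeta>))))"
  define G where "G = (\<lambda>\<zeta>. log_plus (cmod (boundary_function f \<zeta>)))"
  note [measurable] = boundary_function_measurable[OF hol]
  have Gm [measurable]: "G \<in> borel_measurable circle_measure"
    unfolding G_def by measurable
  have u_lim: "(\<lambda>n. \<integral>\<^sup>+ \<zeta>. ennreal (u n \<zeta>) \<partial>circle_measure) \<longlonglongrightarrow> (\<integral>\<^sup>+ \<zeta>. ennreal (G \<zeta>) \<partial>circle_measure)"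
    unfolding u_def G_def by (rule filterlim_compose[OF lim radius_seq_at_left])
  have "(\<integral>\<^sup>+ \<zeta>. ennreal (G \<zeta>) \<partial>circle_measure)
      \<le> (SUP r\<in>{0<..<1}. \<integral>\<^sup>+ \<zeta>. ennreal (log_plus (cmod (f (of_real r * \<zeta>)))) \<partial>circle_measure)"
    by (rule LIMSEQ_le_const2[OF u_lim]) (auto simp: u_def radius_seq intro!: exI[of _ 0] SUP_upper)
  also note nev
  finally have G_fin: "(\<integral>\<^sup>+ \<zeta>. ennreal (G \<zeta>) \<partial>circle_measure) < \<infinity>" .
  hence intG: "integrable circle_measure G"
    by (intro integrableI_bounded) (auto simp: G_def)
  thus "integrable circle_measure (\<lambda>\<zeta>. log_plus (cmod (boundary_function f \<zeta>)))"
    by (simp add: G_def)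
  show "log_plus (cmod (f z))
           \<le> (\<integral>\<zeta>. poisson z \<zeta> * log_plus (cmod (boundary_function f \<zeta>)) \<partial>circle_measure)"
    if z: "cmod z < 1"
  proof -
    define K where "K = 2 / (1 - cmod z)"
    have K: "K > 0" "\<And>\<zeta>. cmod \<zeta> = 1 \<Longrightarrow> poisson z \<zeta> \<le> K"
      using z poisson_le by (auto simp: K_def)
    define a where "a = (\<lambda>n. log_plus (cmod (f (of_real (radius_seq n) * z))))"
    have cu: "continuous_on (sphere 0 1) (u n)" for n
      unfolding u_def using continuous_on_dilation(1)[OF hol radius_seq, of n]
      by (intro continuous_intros) (rule continuous_on_subset, auto)
    have intu: "integrable circle_measure (u n)" for n
      by (rule continuous_on_integrable_circle[OF cu])
    have intPu: "integrable circle_measure (\<lambda>\<zeta>. poisson z \<zeta> * u n \<zeta>)" for n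
      by (intro continuous_on_integrable_circle continuous_intros cu z)
    have intPG: "integrable circle_measure (\<lambda>\<zeta>. poisson z \<zeta> * G \<zeta>)"
      by (rule integrable_poisson_mult[OF intG z])
    have "(\<integral>\<^sup>+ \<zeta>. ennreal (a n + (K - poisson z \<zeta>) * u n \<zeta>) \<partial>circle_measure)
        \<le> ennreal K * (\<integral>\<^sup>+ \<zeta>. ennreal (u n \<zeta>) \<partial>circle_measure)" for n
    proof -
      have "a n \<le> (\<integral>\<zeta>. poisson z \<zeta> * u n \<zeta> \<partial>circle_measure)"
        unfolding a_def u_def
        by (rule log_plus_le_poisson) (intro continuous_on_dilation hol radius_seq z)+
      hence "(\<integral>\<zeta>. a n + (K * u n \<zeta> - poisson z \<zeta> * u n \<zeta>) \<partial>circle_measure)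
          \<le> K * (\<integral>\<zeta>. u n \<zeta> \<partial>circle_measure)"
        using intu[of n] intPu[of n] by (simp add: circle.prob_space)
      moreover have "(\<integral>\<^sup>+ \<zeta>. ennreal (a n + (K - poisson z \<zeta>) * u n \<zeta>) \<partial>circle_measure)
          = ennreal (\<integral>\<zeta>. a n + (K * u n \<zeta> - poisson z \<zeta> * u n \<zeta>) \<partial>circle_measure)"
        using intu[of n] intPu[of n] K(2)
        by (subst nn_integral_eq_integral[symmetric])
           (auto simp: algebra_simps space_circle_measure a_def u_def
                 intro!: AE_I2 add_increasing mult_right_mono)
      moreover have "(\<integral>\<^sup>+ \<zeta>. ennreal (u n \<zeta>) \<partial>circle_measure) = ennreal (\<integral>\<zeta>. u n \<zeta> \<partial>circle_measure)"
        using intu[of n] by (intro nn_integral_eq_integral) (auto simp: u_def)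
      ultimately show ?thesis using K(1)
        by (simp add: ennreal_mult'[symmetric] ennreal_leI)
    qed
    note upper = this
    have a_lim: "a \<longlonglongrightarrow> log_plus (cmod (f z))"
    proof -
      have "isCont f z"
        using hol z by (intro continuous_on_interior[of "ball 0 1"])
           (auto intro: holomorphic_on_imp_continuous_on)
      hence "(\<lambda>n. f (of_real (radius_seq n) * z)) \<longlonglongrightarrow> f z"
        using radius_seq_tendsto isCont_tendsto_compose by blast
      thus ?thesis unfolding a_def log_plus_eq[OF norm_ge_zero]
        by (intro tendsto_intros) auto
    qed
    have "ennreal (log_plus (cmod (f z)) + (K - poisson z \<zeta>) * G \<zeta>)
        \<le> liminf (\<lambda>n. ennreal (a n + (K - poisson z \<zeta>) * u n \<zeta>))"
      if "\<zeta> \<in> space circle_measure" for \<zeta>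
    proof -
      have \<zeta>: "cmod \<zeta> = 1" using that by (simp add: space_circle_measure)
      show ?thesis
      proof (cases "\<exists>l. has_nontangential_limit f \<zeta> l")
        case True
        then obtain l where l: "has_nontangential_limit f \<zeta> l" by blast
        from filterlim_compose[OF has_nontangential_limit_radial[OF l \<zeta>] radius_seq_at_left]
        have "(\<lambda>n. u n \<zeta>) \<longlonglongrightarrow> G \<zeta>"
          unfolding u_def G_def log_plus_eq[OF norm_ge_zero] boundary_function_eq[OF l \<zeta>]
          by (intro tendsto_intros) auto
        hence "(\<lambda>n. ennreal (a n + (K - poisson z \<zeta>) * u n \<zeta>))
            \<longlonglongrightarrow> ennreal (log_plus (cmod (f z)) + (K - poisson z \<zeta>) * G \<zeta>)"
          by (intro tendsto_intros a_lim)
        from lim_imp_Liminf[OF _ this] show ?thesis by simp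
      next
        case False
        hence "G \<zeta> = 0"
          unfolding G_def boundary_function_def if_not_P[OF False] by (simp add: log_plus_def)
        have "(\<lambda>n. ennreal (a n)) \<longlonglongrightarrow> ennreal (log_plus (cmod (f z)))"
          by (intro tendsto_intros a_lim)
        from lim_imp_Liminf[OF _ this] have "ennreal (log_plus (cmod (f z))) = liminf (\<lambda>n. ennreal (a n))"
          by simp
        also have "\<dots> \<le> liminf (\<lambda>n. ennreal (a n + (K - poisson z \<zeta>) * u n \<zeta>))"
          using K(2)[OF \<zeta>]
          by (intro Liminf_mono always_eventually allI ennreal_leI) (simp add: u_def)
        finally show ?thesis using \<open>G \<zeta> = 0\<close> by simp
      qed
    qed
    hence "(\<integral>\<^sup>+ \<zeta>. ennreal (log_plus (cmod (f z)) + (K - poisson z \<zeta>) * G \<zeta>) \<partial>circle_measure)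
        \<le> (\<integral>\<^sup>+ \<zeta>. liminf (\<lambda>n. ennreal (a n + (K - poisson z \<zeta>) * u n \<zeta>)) \<partial>circle_measure)"
      by (rule nn_integral_mono)
    also have "\<dots> \<le> liminf (\<lambda>n. \<integral>\<^sup>+ \<zeta>. ennreal (a n + (K - poisson z \<zeta>) * u n \<zeta>) \<partial>circle_measure)"
      using intu by (intro nn_integral_liminf) (auto dest: borel_measurable_integrable)
    also have "\<dots> \<le> liminf (\<lambda>n. ennreal K * (\<integral>\<^sup>+ \<zeta>. ennreal (u n \<zeta>) \<partial>circle_measure))"
      by (intro Liminf_mono always_eventually allI upper)
    also have "\<dots> = ennreal K * (\<integral>\<^sup>+ \<zeta>. ennreal (G \<zeta>) \<partial>circle_measure)"
      by (intro lim_imp_Liminf ennreal_tendsto_cmult u_lim) auto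
    also have "\<dots> = ennreal (K * (\<integral>\<zeta>. G \<zeta> \<partial>circle_measure))"
      using intG K(1) by (subst nn_integral_eq_integral) (auto simp: G_def ennreal_mult')
    also have "(\<integral>\<^sup>+ \<zeta>. ennreal (log_plus (cmod (f z)) + (K - poisson z \<zeta>) * G \<zeta>) \<partial>circle_measure)
        = ennreal (\<integral>\<zeta>. log_plus (cmod (f z)) + (K * G \<zeta> - poisson z \<zeta> * G \<zeta>) \<partial>circle_measure)"
      using intG intPG K(2)
      by (subst nn_integral_eq_integral[symmetric])
         (auto simp: algebra_simps space_circle_measure G_def
               intro!: AE_I2 add_increasing mult_right_mono)
    finally have "(\<integral>\<zeta>. log_plus (cmod (f z)) + (K * G \<zeta> - poisson z \<zeta> * G \<zeta>) \<partial>circle_measure)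
        \<le> K * (\<integral>\<zeta>. G \<zeta> \<partial>circle_measure)"
      by (subst (asm) ennreal_le_iff) (use K(1) in \<open>auto simp: G_def intro!: mult_nonneg_nonneg integral_nonneg_AE\<close>)
    thus ?thesis using intG intPG by (simp add: circle.prob_space G_def)
  qed
qed

section \<open>Weak-type estimates\<close>

text \<open>Fubini's theorem for the region below the graph of \<open>X\<close>.\<close>

lemma (in sigma_finite_measure) layer_cake:
  fixes X :: "'a \<Rightarrow> real" and \<phi> :: "real \<Rightarrow> ennreal"
  assumes [measurable]: "X \<in> borel_measurable M" "\<phi> \<in> borel_measurable borel"
  shows "(\<integral>\<^sup>+ x. (\<integral>\<^sup>+ t. \<phi> t * indicator {0<..<X x} t \<partial>lborel) \<partial>M)
       = (\<integral>\<^sup>+ t. \<phi> t * indicator {0<..} t * emeasure M {x \<in> space M. t < X x} \<partial>lborel)"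
proof -
  interpret pair_sigma_finite lborel M by unfold_locales
  have eq: "\<phi> t * indicator {0<..<X x} t = \<phi> t * (if 0 < t \<and> t < X x then 1 else 0)" for t x
    by (auto simp: indicator_def)
  have "(\<integral>\<^sup>+ x. (\<integral>\<^sup>+ t. \<phi> t * indicator {0<..<X x} t \<partial>lborel) \<partial>M)
      = (\<integral>\<^sup>+ t. (\<integral>\<^sup>+ x. \<phi> t * indicator {0<..<X x} t \<partial>M) \<partial>lborel)"
    unfolding eq by (rule Fubini') measurable
  also have "\<dots> = (\<integral>\<^sup>+ t. (\<integral>\<^sup>+ x. (\<phi> t * indicator {0<..} t) * indicator {x \<in> space M. t < X x} x \<partial>M) \<partial>lborel)"
    by (intro nn_integral_cong) (auto simp: indicator_def)
  also have "\<dots> = (\<integral>\<^sup>+ t. \<phi> t * indicator {0<..} t * emeasure M {x \<in> space M. t < X x} \<partial>lborel)"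
    by (intro nn_integral_cong nn_integral_cmult_indicator) measurable
  finally show ?thesis .
qed

lemma (in finite_measure) weak_L2_excess_bound:
  fixes X :: "'a \<Rightarrow> real"
  assumes [measurable]: "X \<in> borel_measurable M" and C: "0 \<le> C"
    and weak: "\<And>t. t > 0 \<Longrightarrow> measure M {x \<in> space M. t < X x} \<le> C / t\<^sup>2" and T: "T > 0"
  shows "(\<integral>\<^sup>+ x. ennreal (X x - T) \<partial>M) \<le> ennreal (C / T)"
proof -
  have "(\<integral>\<^sup>+ x. ennreal (X x - T) \<partial>M)
      = (\<integral>\<^sup>+ x. (\<integral>\<^sup>+ t. indicator {T<..} t * indicator {0<..<X x} t \<partial>lborel) \<partial>M)"
  proof (intro nn_integral_cong)
    fix x
    have "(\<integral>\<^sup>+ t. indicator {T<..} t * indicator {0<..<X x} t \<partial>lborel)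
        = (\<integral>\<^sup>+ t. indicator {T<..<X x} t \<partial>lborel)"
      using T by (intro nn_integral_cong) (auto simp: indicator_def)
    also have "\<dots> = ennreal (X x - T)"
      by (cases "T \<le> X x") (auto simp: ennreal_neg)
    finally show "ennreal (X x - T) = (\<integral>\<^sup>+ t. indicator {T<..} t * indicator {0<..<X x} t \<partial>lborel)" ..
  qed
  also have "\<dots> = (\<integral>\<^sup>+ t. indicator {T<..} t * indicator {0<..} t * emeasure M {x \<in> space M. t < X x} \<partial>lborel)"
    by (rule layer_cake) measurable
  also have "\<dots> \<le> (\<integral>\<^sup>+ t. ennreal (C / t\<^sup>2) * indicator {T..} t \<partial>lborel)"
    using weak T by (intro nn_integral_mono) (auto simp: indicator_def emeasure_eq_measure intro!: ennreal_leI)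
  also have "\<dots> = ennreal (0 - (- C / T))"
  proof (rule nn_integral_FTC_atLeast)
    show "((\<lambda>t. - C / t) has_real_derivative C / t\<^sup>2) (at t)" if "T \<le> t" for t
      using that T by (auto intro!: derivative_eq_intros simp: power2_eq_square)
    show "((\<lambda>t. - C / t) \<longlongrightarrow> 0) at_top" by real_asymp
  qed (use C in auto)
  finally show ?thesis by simp
qed

lemma (in finite_measure) weak_L2_integrable:
  fixes X :: "'a \<Rightarrow> real"
  assumes [measurable]: "X \<in> borel_measurable M" and C: "0 \<le> C" and nonneg: "\<And>x. 0 \<le> X x"
    and weak: "\<And>t. t > 0 \<Longrightarrow> measure M {x \<in> space M. t < X x} \<le> C / t\<^sup>2"
  shows "integrable M X"
proof (rule integrableI_bounded)
  have "(\<integral>\<^sup>+x. ennreal (norm (X x)) \<partial>M) \<le> (\<integral>\<^sup>+x. 1 + ennreal (X x - 1) \<partial>M)"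
  proof (intro nn_integral_mono)
    fix x
    show "ennreal (norm (X x)) \<le> 1 + ennreal (X x - 1)"
    proof (cases "X x \<le> 1")
      case True
      hence "ennreal (X x) \<le> 1" by (simp add: ennreal_le_1)
      thus ?thesis using nonneg[of x] by (simp add: add_increasing2)
    next
      case False
      thus ?thesis
        by (simp add: ennreal_1[symmetric] ennreal_plus[symmetric] del: ennreal_1 ennreal_plus)
    qed
  qed
  also have "\<dots> = emeasure M (space M) + (\<integral>\<^sup>+x. ennreal (X x - 1) \<partial>M)"
    by (subst nn_integral_add) auto
  also have "\<dots> \<le> emeasure M (space M) + ennreal (C / 1)"
    by (intro add_left_mono weak_L2_excess_bound weak C) auto
  also have "\<dots> < \<infinity>" by (simp add: emeasure_eq_measure)
  finally show "(\<integral>\<^sup>+x. ennreal (norm (X x)) \<partial>M) < \<infinity>" .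
qed measurable

text \<open>The layer cake formula with \<open>\<phi> t = a * t powr (a - 1)\<close>, where the levels above \<open>A\<close> do not
  contribute. Levels below 1 are cut off and replaced by the summand \<open>measure M (space M)\<close>.\<close>

lemma (in finite_measure) weak_L2_powr_bound:
  fixes X :: "'a \<Rightarrow> real"
  assumes [measurable]: "X \<in> borel_measurable M" and C: "0 \<le> C"
    and weak: "\<And>t. t > 0 \<Longrightarrow> measure M {x \<in> space M. t < X x} \<le> C / t\<^sup>2"
    and nonneg: "\<And>x. x \<in> space M \<Longrightarrow> 0 \<le> X x" and bound: "\<And>x. x \<in> space M \<Longrightarrow> X x \<le> A"
    and A: "1 \<le> A" and a: "2 < a"
  shows "(\<integral>\<^sup>+ x. ennreal (X x powr a) \<partial>M) \<le> ennreal (measure M (space M) + a * C / (a - 2) * A powr (a - 2))"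
proof -
  define \<phi> where "\<phi> = (\<lambda>t::real. ennreal (a * t powr (a - 1)) * indicator {1..} t)"
  have [measurable]: "\<phi> \<in> borel_measurable borel" unfolding \<phi>_def by measurable
  have "(\<integral>\<^sup>+ x. ennreal (X x powr a) \<partial>M)
      \<le> (\<integral>\<^sup>+ x. 1 + (\<integral>\<^sup>+ t. \<phi> t * indicator {0<..<X x} t \<partial>lborel) \<partial>M)"
  proof (intro nn_integral_mono)
    fix x assume x: "x \<in> space M"
    show "ennreal (X x powr a) \<le> 1 + (\<integral>\<^sup>+ t. \<phi> t * indicator {0<..<X x} t \<partial>lborel)"
    proof (cases "X x \<le> 1")
      case True
      hence "X x powr a \<le> 1" using nonneg[OF x] a by (simp add: powr_le1)
      hence "ennreal (X x powr a) \<le> 1" by (simp add: ennreal_le_1)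
      thus ?thesis by (rule order_trans) simp
    next
      case False
      have "(\<integral>\<^sup>+ t. \<phi> t * indicator {0<..<X x} t \<partial>lborel)
          = (\<integral>\<^sup>+ t. ennreal (a * t powr (a - 1)) * indicator {1..X x} t \<partial>lborel)"
        using AE_lborel_singleton[of "X x"]
        by (intro nn_integral_cong_AE) (auto simp: \<phi>_def indicator_def elim!: eventually_mono)
      also have "\<dots> = ennreal (X x powr a - 1 powr a)"
        using False a
        by (intro nn_integral_FTC_Icc) (auto intro!: derivative_eq_intros)
      finally show ?thesis
        using False a by (simp add: ennreal_plus[symmetric] ennreal_1[symmetric] ge_one_powr_ge_zero
            del: ennreal_plus ennreal_1)
    qed
  qed
  also have "\<dots> = emeasure M (space M) + (\<integral>\<^sup>+ x. (\<integral>\<^sup>+ t. \<phi> t * indicator {0<..<X x} t \<partial>lborel) \<partial>M)"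
  proof (subst nn_integral_add)
    have "\<phi> t * indicator {0<..<X x} t = \<phi> t * (if 0 < t \<and> t < X x then 1 else 0)" for t x
      by (auto simp: indicator_def)
    thus "(\<lambda>x. \<integral>\<^sup>+ t. \<phi> t * indicator {0<..<X x} t \<partial>lborel) \<in> borel_measurable M"
      by (simp only:) measurable
  qed auto
  also have "(\<integral>\<^sup>+ x. (\<integral>\<^sup>+ t. \<phi> t * indicator {0<..<X x} t \<partial>lborel) \<partial>M)
      = (\<integral>\<^sup>+ t. \<phi> t * indicator {0<..} t * emeasure M {x \<in> space M. t < X x} \<partial>lborel)"
    by (rule layer_cake) measurable
  also have "\<dots> \<le> (\<integral>\<^sup>+ t. ennreal (a * C * t powr (a - 3)) * indicator {1..A} t \<partial>lborel)"
  proof (intro nn_integral_mono)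
    fix t :: real
    consider "t < 1" | "1 \<le> t" "t \<le> A" | "t > A" by linarith
    thus "\<phi> t * indicator {0<..} t * emeasure M {x \<in> space M. t < X x}
        \<le> ennreal (a * C * t powr (a - 3)) * indicator {1..A} t"
    proof cases
      case 2
      have "a * t powr (a - 1) * measure M {x \<in> space M. t < X x} \<le> a * t powr (a - 1) * (C / t\<^sup>2)"
        using 2 a by (intro mult_left_mono weak) auto
      also have "\<dots> = a * C * (t powr (a - 1) / t powr 2)"
        using 2 by (simp add: powr_numeral)
      also have "t powr (a - 1) / t powr 2 = t powr (a - 3)"
        by (simp add: powr_diff[symmetric])
      finally show ?thesis
        using 2 a by (simp add: \<phi>_def emeasure_eq_measure ennreal_mult'[symmetric] ennreal_leI)
    next
      case 3
      hence "{x \<in> space M. t < X x} = {}" using bound by force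
      thus ?thesis by (simp only: emeasure_empty) simp
    qed (simp add: \<phi>_def)
  qed
  also have "\<dots> = ennreal (a * C / (a - 2) * A powr (a - 2) - a * C / (a - 2) * 1 powr (a - 2))"
    using A a C
    by (intro nn_integral_FTC_Icc) (auto intro!: derivative_eq_intros)
  also have "\<dots> \<le> ennreal (a * C / (a - 2) * A powr (a - 2))"
    using a C by (intro ennreal_leI) auto
  finally show ?thesis
    using a C by (simp add: emeasure_eq_measure add_left_mono)
qed

section \<open>Poisson integrals of functions in weak \<open>L\<^sup>2\<close>\<close>

definition poisson_integral :: "(complex \<Rightarrow> real) \<Rightarrow> complex \<Rightarrow> real" where
  "poisson_integral g z = (\<integral>\<zeta>. poisson z \<zeta> * g \<zeta> \<partial>circle_measure)"

text \<open>Jensen's inequality for the convex function \<open>x \<mapsto> max 0 (x - T)\<close>; the maximum with \<open>0\<close> is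
  hidden in \<open>ennreal\<close>.\<close>

lemma poisson_integral_excess:
  assumes g: "integrable circle_measure g" and z: "cmod z < 1"
  shows "ennreal (poisson_integral g z - T) \<le> (\<integral>\<^sup>+\<zeta>. ennreal (poisson z \<zeta>) * ennreal (g \<zeta> - T) \<partial>circle_measure)"
proof -
  note int = integrable_poisson_mult[OF g z]
  have intP: "integrable circle_measure (poisson z)"
    using z by (intro continuous_on_integrable_circle continuous_intros)
  have int1: "integrable circle_measure (\<lambda>\<zeta>. poisson z \<zeta> * (g \<zeta> - T))"
    using int intP by (simp add: right_diff_distrib)
  have "poisson_integral g z - T = (\<integral>\<zeta>. poisson z \<zeta> * (g \<zeta> - T) \<partial>circle_measure)"
    unfolding poisson_integral_def using int intP by (simp add: right_diff_distrib integral_poisson[OF z])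
  also have "\<dots> \<le> (\<integral>\<zeta>. max 0 (poisson z \<zeta> * (g \<zeta> - T)) \<partial>circle_measure)"
    using int1 by (intro integral_mono) auto
  finally have "ennreal (poisson_integral g z - T)
      \<le> ennreal (\<integral>\<zeta>. max 0 (poisson z \<zeta> * (g \<zeta> - T)) \<partial>circle_measure)" by (rule ennreal_leI)
  also have "\<dots> = (\<integral>\<^sup>+\<zeta>. ennreal (max 0 (poisson z \<zeta> * (g \<zeta> - T))) \<partial>circle_measure)"
    using int1 by (intro nn_integral_eq_integral[symmetric]) auto
  also have "\<dots> = (\<integral>\<^sup>+\<zeta>. ennreal (poisson z \<zeta>) * ennreal (g \<zeta> - T) \<partial>circle_measure)"
    by (simp add: ennreal_mult'[OF poisson_nonneg[OF z], symmetric] ennreal_max_0)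
  finally show ?thesis .
qed

text \<open>Below the level \<open>T\<close> the mean is at most \<open>T\<close>; the excess over \<open>T\<close> contributes at most its integral
  \<open>C / T\<close> times the maximum \<open>2 / (1 - |z|)\<close> of the kernel. The choice \<open>T = (1 - |z|) powr (-1/2)\<close>
  balances the two.\<close>

lemma weak_L2_poisson_integral_sup:
  assumes g: "integrable circle_measure g" and C: "0 \<le> C"
    and weak: "\<And>t. t > 0 \<Longrightarrow> measure circle_measure {\<zeta> \<in> space circle_measure. t < g \<zeta>} \<le> C / t\<^sup>2"
    and z: "cmod z < 1"
  shows "poisson_integral g z \<le> (1 + 2 * C) * (1 - cmod z) powr (-1/2)"
proof -
  define T where "T = (1 - cmod z) powr (-1/2)"
  have T: "T > 0" using z by (simp add: T_def)
  have TT: "T * T = 1 / (1 - cmod z)"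
    using z by (simp add: T_def powr_add[symmetric] powr_minus_divide)
  have [measurable]: "g \<in> borel_measurable circle_measure" using g by simp
  have "ennreal (poisson_integral g z - T) \<le> (\<integral>\<^sup>+\<zeta>. ennreal (poisson z \<zeta>) * ennreal (g \<zeta> - T) \<partial>circle_measure)"
    by (rule poisson_integral_excess[OF g z])
  also have "\<dots> \<le> (\<integral>\<^sup>+\<zeta>. ennreal (2 / (1 - cmod z)) * ennreal (g \<zeta> - T) \<partial>circle_measure)"
    using poisson_le[OF _ z] by (intro nn_integral_mono mult_right_mono ennreal_leI) (auto simp: space_circle_measure)
  also have "\<dots> = ennreal (2 / (1 - cmod z)) * (\<integral>\<^sup>+\<zeta>. ennreal (g \<zeta> - T) \<partial>circle_measure)"
    by (rule nn_integral_cmult) measurable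
  also have "\<dots> \<le> ennreal (2 / (1 - cmod z)) * ennreal (C / T)"
    by (intro mult_left_mono circle.weak_L2_excess_bound weak T C) auto
  also have "\<dots> = ennreal (2 * (T * T) * (C / T))"
    using z unfolding TT by (simp add: ennreal_mult'[symmetric])
  also have "2 * (T * T) * (C / T) = 2 * C * T" using T by (simp add: field_simps)
  finally have "poisson_integral g z - T \<le> 2 * C * T"
    by (subst (asm) ennreal_le_iff) (use C T in auto)
  thus ?thesis unfolding T_def[symmetric] by (simp add: algebra_simps)
qed

lemma pair_circle_measurable_poisson [measurable]:
  "(\<lambda>(\<xi>, \<zeta>). poisson (of_real r * \<xi>) \<zeta>) \<in> borel_measurable (circle_measure \<Otimes>\<^sub>M circle_measure)"
  unfolding poisson_def by measurable

lemma poisson_integral_measurable: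
  assumes [measurable]: "g \<in> borel_measurable circle_measure"
  shows "(\<lambda>\<xi>. poisson_integral g (of_real r * \<xi>)) \<in> borel_measurable circle_measure"
  unfolding poisson_integral_def by measurable

lemma nn_integral_poisson_average:
  assumes [measurable]: "\<psi> \<in> borel_measurable circle_measure" and r: "0 < r" "r < 1"
  shows "(\<integral>\<^sup>+\<xi>. (\<integral>\<^sup>+\<zeta>. ennreal (poisson (of_real r * \<xi>) \<zeta>) * \<psi> \<zeta> \<partial>circle_measure) \<partial>circle_measure)
       = (\<integral>\<^sup>+\<zeta>. \<psi> \<zeta> \<partial>circle_measure)"
proof -
  interpret pair_sigma_finite circle_measure circle_measure by unfold_locales
  have "(\<integral>\<^sup>+\<xi>. (\<integral>\<^sup>+\<zeta>. ennreal (poisson (of_real r * \<xi>) \<zeta>) * \<psi> \<zeta> \<partial>circle_measure) \<partial>circle_measure)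
      = (\<integral>\<^sup>+\<zeta>. (\<integral>\<^sup>+\<xi>. ennreal (poisson (of_real r * \<xi>) \<zeta>) * \<psi> \<zeta> \<partial>circle_measure) \<partial>circle_measure)"
    by (rule Fubini'[symmetric]) measurable
  also have "\<dots> = (\<integral>\<^sup>+\<zeta>. \<psi> \<zeta> \<partial>circle_measure)"
  proof (intro nn_integral_cong)
    fix \<zeta> assume "\<zeta> \<in> space circle_measure"
    hence \<zeta>: "cmod \<zeta> = 1" by (simp add: space_circle_measure)
    have "(\<integral>\<^sup>+\<xi>. ennreal (poisson (of_real r * \<xi>) \<zeta>) * \<psi> \<zeta> \<partial>circle_measure)
        = (\<integral>\<^sup>+\<xi>. ennreal (poisson (of_real r * \<zeta>) \<xi>) * \<psi> \<zeta> \<partial>circle_measure)"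
      using \<zeta> by (intro nn_integral_cong) (auto simp: space_circle_measure poisson_sym)
    also have "\<dots> = \<psi> \<zeta>"
      using r \<zeta> by (subst nn_integral_multc) (auto simp: nn_integral_poisson norm_mult)
    finally show "(\<integral>\<^sup>+\<xi>. ennreal (poisson (of_real r * \<xi>) \<zeta>) * \<psi> \<zeta> \<partial>circle_measure) = \<psi> \<zeta>" .
  qed
  finally show ?thesis .
qed

text \<open>The weak-type bound passes to the Poisson integral on every circle with a constant that does not
  depend on the radius: averaging over the circle does not increase the integral of the excess over
  \<open>t/2\<close>, and Chebyshev's inequality turns that integral back into a bound at level \<open>t\<close>.\<close>

lemma weak_L2_poisson_integral:
  assumes g: "integrable circle_measure g" and C: "0 \<le> C"
    and weak: "\<And>t. t > 0 \<Longrightarrow> measure circle_measure {\<zeta> \<in> space circle_measure. t < g \<zeta>} \<le> C / t\<^sup>2"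
    and r: "0 < r" "r < 1" and t: "t > 0"
  shows "measure circle_measure {\<xi> \<in> space circle_measure. t < poisson_integral g (of_real r * \<xi>)} \<le> 4 * C / t\<^sup>2"
proof -
  have gm [measurable]: "g \<in> borel_measurable circle_measure" using g by simp
  note [measurable] = poisson_integral_measurable[OF gm]
  let ?h = "\<lambda>\<xi>. poisson_integral g (of_real r * \<xi>)"
  let ?S = "{\<xi> \<in> space circle_measure. t < ?h \<xi>}"
  have "ennreal (t/2) * emeasure circle_measure ?S = (\<integral>\<^sup>+\<xi>. ennreal (t/2) * indicator ?S \<xi> \<partial>circle_measure)"
    by (rule nn_integral_cmult_indicator[symmetric]) measurable
  also have "\<dots> \<le> (\<integral>\<^sup>+\<xi>. ennreal (?h \<xi> - t/2) \<partial>circle_measure)"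
    by (intro nn_integral_mono) (auto simp: indicator_def intro!: ennreal_leI)
  also have "\<dots> \<le> (\<integral>\<^sup>+\<xi>. (\<integral>\<^sup>+\<zeta>. ennreal (poisson (of_real r * \<xi>) \<zeta>) * ennreal (g \<zeta> - t/2)
      \<partial>circle_measure) \<partial>circle_measure)"
    using r by (intro nn_integral_mono poisson_integral_excess g) (auto simp: space_circle_measure norm_mult)
  also have "\<dots> = (\<integral>\<^sup>+\<zeta>. ennreal (g \<zeta> - t/2) \<partial>circle_measure)"
    by (rule nn_integral_poisson_average[OF _ r]) measurable
  also have "\<dots> \<le> ennreal (C / (t/2))"
    by (rule circle.weak_L2_excess_bound) (use t weak C in auto)
  finally have "t/2 * measure circle_measure ?S \<le> C / (t/2)"
    using t C by (simp add: circle.emeasure_eq_measure ennreal_mult'[symmetric])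
  thus ?thesis using t by (simp add: field_simps power2_eq_square)
qed

section \<open>Growth of the Taylor coefficients\<close>

text \<open>A bound \<open>B * s powr (-1/p)\<close> for the decreasing rearrangement is inverted to one for the distribution
  function. The infimum defining the rearrangement is informative only if it is taken over a nonempty
  set, that is, if the distribution function tends to \<open>0\<close>; this follows from the integrability of
  \<open>log\<^sup>+\<close> of the boundary function.\<close>

lemma weak_hardy_distribution_bound:
  assumes p: "0 < p" and f: "f \<in> weak_hardy p"
  shows "\<exists>C\<ge>0. \<forall>t>0. distribution_function (boundary_function f) t \<le> C * t powr (-p)"
proof -
  let ?d = "distribution_function (boundary_function f)"
  define G where "G = (\<lambda>\<zeta>. log_plus (cmod (boundary_function f \<zeta>)))"
  have fs: "f \<in> smirnov_class"
    and "bdd_above ((\<lambda>s. decreasing_rearrangement (boundary_function f) s * s powr (1/p)) ` {0<..})"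
    using f by (auto simp: weak_hardy_def)
  then obtain B0 where B0: "\<And>s. s > 0 \<Longrightarrow> decreasing_rearrangement (boundary_function f) s * s powr (1/p) \<le> B0"
    by (auto simp: bdd_above_def)
  define B where "B = max 1 B0"
  have B: "B > 0" "\<And>s. s > 0 \<Longrightarrow> decreasing_rearrangement (boundary_function f) s * s powr (1/p) \<le> B"
    using B0 by (auto simp: B_def intro: max.coboundedI2)
  have "f holomorphic_on ball 0 1" using fs by (auto simp: smirnov_class_def nevanlinna_class_def)
  note [measurable] = boundary_function_measurable[OF this]
  have d_mono: "?d t \<le> ?d t'" if "t' \<le> t" for t t'
    unfolding distribution_function_def space_circle_measure[symmetric]
    using that by (intro circle.finite_measure_mono) auto
  have intG: "integrable circle_measure G"
    unfolding G_def by (rule smirnov_class_boundary(1)[OF fs])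
  have IG: "0 \<le> (\<integral>\<zeta>. G \<zeta> \<partial>circle_measure)" by (intro integral_nonneg_AE) (auto simp: G_def)
  have nonempty: "\<exists>t\<ge>0. ?d t \<le> s" if s: "s > 0" for s
  proof -
    define c where "c = ((\<integral>\<zeta>. G \<zeta> \<partial>circle_measure) + 1) / s"
    have c: "c > 0" using IG s by (simp add: c_def)
    have "?d (exp c) \<le> measure circle_measure {\<zeta> \<in> space circle_measure. G \<zeta> \<ge> c}"
      unfolding distribution_function_def space_circle_measure[symmetric]
    proof (intro circle.finite_measure_mono)
      show "{\<zeta> \<in> space circle_measure. exp c < cmod (boundary_function f \<zeta>)} \<subseteq> {\<zeta> \<in> space circle_measure. c \<le> G \<zeta>}"
      proof safe
        fix \<zeta> assume "exp c < cmod (boundary_function f \<zeta>)"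
        hence "exp c \<le> exp (G \<zeta>)" by (simp add: G_def exp_log_plus)
        thus "c \<le> G \<zeta>" by simp
      qed
    qed (auto simp: G_def)
    also have "\<dots> \<le> (\<integral>\<zeta>. G \<zeta> \<partial>circle_measure) / c"
      by (rule integral_Markov_inequality_measure[where A = "{}"]) (use intG c in \<open>auto simp: G_def\<close>)
    also have "\<dots> \<le> s"
      using IG s by (simp add: c_def field_simps)
    finally show ?thesis by (intro exI[of _ "exp c"]) auto
  qed
  have "?d t \<le> ((2 * B) powr p) * t powr (-p)" if t: "t > 0" for t
  proof -
    \<comment> \<open>The factor 2 makes the rearrangement at \<open>s\<close> strictly smaller than \<open>t\<close>, so that some level below
      \<open>t\<close> is admissible in the infimum.\<close>
    define s where "s = (2 * B / t) powr p"
    have s: "s > 0" using B t by (simp add: s_def)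
    have "s powr (1/p) = 2 * B / t" using B t p by (simp add: s_def powr_powr)
    hence "decreasing_rearrangement (boundary_function f) s * (2 * B / t) \<le> B" using B(2)[OF s] by simp
    hence "decreasing_rearrangement (boundary_function f) s \<le> t / 2" using B(1) t by (simp add: field_simps)
    hence "Inf {t. 0 \<le> t \<and> ?d t \<le> s} < t" using t by (simp add: decreasing_rearrangement_def)
    moreover have "{t. 0 \<le> t \<and> ?d t \<le> s} \<noteq> {}" using nonempty[OF s] by auto
    ultimately obtain t' where "0 \<le> t'" "?d t' \<le> s" "t' < t"
      using cInf_lessD[of "{t. 0 \<le> t \<and> ?d t \<le> s}" t] by auto
    hence "?d t \<le> s" using d_mono[of t' t] by simp
    also have "s = ((2 * B) powr p) * t powr (-p)"
      using B t by (simp add: s_def powr_divide powr_minus_divide)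
    finally show ?thesis .
  qed
  thus ?thesis by (intro exI[of _ "(2 * B) powr p"]) simp
qed

text \<open>Jensen's inequality, by integrating the tangent line of \<open>exp\<close> at the mean \<open>c\<close>.\<close>

lemma poisson_jensen_exp:
  assumes X: "integrable circle_measure X" and eX: "integrable circle_measure (\<lambda>\<zeta>. exp (X \<zeta>))"
    and z: "cmod z < 1"
  shows "exp (poisson_integral X z) \<le> poisson_integral (\<lambda>\<zeta>. exp (X \<zeta>)) z"
proof -
  define c where "c = poisson_integral X z"
  have intP: "integrable circle_measure (poisson z)"
    using z by (intro continuous_on_integrable_circle continuous_intros)
  note int = integrable_poisson_mult[OF X z] integrable_poisson_mult[OF eX z] intP
  have "exp c = (\<integral>\<zeta>. exp c * (1 - c) * poisson z \<zeta> + exp c * (poisson z \<zeta> * X \<zeta>) \<partial>circle_measure)"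
    using int by (simp add: integral_poisson[OF z]) (simp add: c_def poisson_integral_def algebra_simps)
  also have "\<dots> \<le> (\<integral>\<zeta>. poisson z \<zeta> * exp (X \<zeta>) \<partial>circle_measure)"
  proof (rule integral_mono)
    fix \<zeta>
    have "exp c * (1 + (X \<zeta> - c)) \<le> exp c * exp (X \<zeta> - c)"
      by (intro mult_left_mono exp_ge_add_one_self) auto
    hence "exp c * (1 + (X \<zeta> - c)) \<le> exp (X \<zeta>)" by (simp add: exp_add[symmetric])
    from mult_left_mono[OF this poisson_nonneg[OF z]]
    show "exp c * (1 - c) * poisson z \<zeta> + exp c * (poisson z \<zeta> * X \<zeta>) \<le> poisson z \<zeta> * exp (X \<zeta>)"
      by (simp add: algebra_simps)
  qed (use int in auto)
  finally show ?thesis by (simp add: c_def poisson_integral_def)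
qed

text \<open>The analogue of the Hardy--Littlewood mean growth theorem. With \<open>g = (max 1 |f\<^sup>*|) powr (p/2)\<close> and
  \<open>a = 2/p\<close>, the previous estimates give \<open>|f z| \<le> P[g] z powr a\<close> with \<open>P[g]\<close> in weak \<open>L\<^sup>2\<close> and of size
  at most \<open>A\<close>, a multiple of \<open>(1 - r) powr (-1/2)\<close>, on the circle of radius \<open>r\<close>. Hence the mean of \<open>|f|\<close> is
  of order \<open>A powr (a - 2)\<close>, and \<open>(a - 2) * (-1/2) = 1 - 1/p\<close>.\<close>

lemma weak_hardy_mean_bound:
  assumes p: "0 < p" "p < 1" and f: "f \<in> weak_hardy p"
  shows "\<exists>K\<ge>0. \<forall>r. 0 < r \<longrightarrow> r < 1 \<longrightarrow>
    (\<integral>\<zeta>. cmod (f (of_real r * \<zeta>)) \<partial>circle_measure) \<le> K * (1 - r) powr (1 - 1/p)"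
proof -
  define a where "a = 2 / p"
  have a: "2 < a" using p by (simp add: a_def field_simps)
  have fs: "f \<in> smirnov_class" using f by (simp add: weak_hardy_def)
  hence hol: "f holomorphic_on ball 0 1" by (auto simp: smirnov_class_def nevanlinna_class_def)
  note [measurable] = boundary_function_measurable[OF hol]
  obtain C0 where C0: "C0 \<ge> 0" "\<And>t. t > 0 \<Longrightarrow> distribution_function (boundary_function f) t \<le> C0 * t powr (-p)"
    using weak_hardy_distribution_bound[OF p(1) f] by blast
  define C where "C = max 1 C0"
  have C: "C \<ge> 0" "C \<ge> 1" "C \<ge> C0" by (auto simp: C_def)
  define G where "G = (\<lambda>\<zeta>. log_plus (cmod (boundary_function f \<zeta>)))"
  define g where "g = (\<lambda>\<zeta>. exp (G \<zeta> / a))"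
  have intG: "integrable circle_measure G"
    unfolding G_def by (rule smirnov_class_boundary(1)[OF fs])
  have gm [measurable]: "g \<in> borel_measurable circle_measure" unfolding g_def G_def by measurable
  have weak: "measure circle_measure {\<zeta> \<in> space circle_measure. t < g \<zeta>} \<le> C / t\<^sup>2" if t: "t > 0" for t
  proof (cases "t \<ge> 1")
    case False
    hence "t\<^sup>2 \<le> 1" using t by (simp add: power_le_one)
    hence "1 \<le> C / t\<^sup>2" using C(2) t by (simp add: field_simps)
    thus ?thesis by (rule order_trans[OF circle.prob_le_1])
  next
    case True
    have "measure circle_measure {\<zeta> \<in> space circle_measure. t < g \<zeta>}
        \<le> distribution_function (boundary_function f) (t powr a)"
      unfolding distribution_function_def space_circle_measure[symmetric]
    proof (intro circle.finite_measure_mono subsetI)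
      fix \<zeta> assume \<zeta>: "\<zeta> \<in> {\<zeta> \<in> space circle_measure. t < g \<zeta>}"
      hence "t powr a < g \<zeta> powr a" using t a by (intro powr_less_mono2) auto
      also have "g \<zeta> powr a = max 1 (cmod (boundary_function f \<zeta>))"
        using a by (simp add: g_def G_def exp_powr_real exp_log_plus)
      finally have "t powr a < max 1 (cmod (boundary_function f \<zeta>))" .
      moreover have "1 \<le> t powr a" using True a by (simp add: ge_one_powr_ge_zero)
      ultimately show "\<zeta> \<in> {\<zeta> \<in> space circle_measure. t powr a < cmod (boundary_function f \<zeta>)}"
        using \<zeta> by (auto simp: less_max_iff_disj)
    qed auto
    also have "\<dots> \<le> C0 * (t powr a) powr (-p)" using t by (intro C0) auto
    also have "(t powr a) powr (-p) = 1 / t\<^sup>2"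
      using t p by (simp add: powr_powr a_def powr_minus_divide powr_numeral)
    also have "C0 * (1 / t\<^sup>2) \<le> C / t\<^sup>2" using C t by (simp add: divide_right_mono)
    finally show ?thesis .
  qed
  have intg: "integrable circle_measure g"
    by (rule circle.weak_L2_integrable[OF gm C(1) _ weak]) (auto simp: g_def)
  have f_le: "cmod (f z) \<le> poisson_integral g z powr a" if z: "cmod z < 1" for z
  proof -
    have "log_plus (cmod (f z)) \<le> poisson_integral G z"
      unfolding poisson_integral_def G_def by (rule smirnov_class_boundary(2)[OF fs z])
    hence "log_plus (cmod (f z)) / a \<le> poisson_integral (\<lambda>\<zeta>. G \<zeta> / a) z"
      using a by (simp add: poisson_integral_def divide_right_mono)
    hence "exp (log_plus (cmod (f z)) / a) \<le> exp (poisson_integral (\<lambda>\<zeta>. G \<zeta> / a) z)" by simp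
    also have "\<dots> \<le> poisson_integral g z"
      unfolding g_def using intG intg by (intro poisson_jensen_exp z) (auto simp: g_def)
    finally have "exp (log_plus (cmod (f z)) / a) powr a \<le> poisson_integral g z powr a"
      using a by (intro powr_mono2) auto
    moreover have "exp (log_plus (cmod (f z)) / a) powr a = max 1 (cmod (f z))"
      using a by (simp add: exp_powr_real exp_log_plus)
    ultimately show ?thesis by simp
  qed
  define K where "K = (1 + a * (4 * C) / (a - 2)) * (1 + 2 * C) powr (a - 2)"
  have K: "K \<ge> 0" unfolding K_def using a C by (intro mult_nonneg_nonneg add_nonneg_nonneg) auto
  have "(\<integral>\<zeta>. cmod (f (of_real r * \<zeta>)) \<partial>circle_measure) \<le> K * (1 - r) powr (1 - 1/p)" if r: "0 < r" "r < 1" for r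
  proof -
    let ?h = "\<lambda>\<xi>. poisson_integral g (of_real r * \<xi>)"
    note hm [measurable] = poisson_integral_measurable[OF gm, of r]
    define A where "A = (1 + 2 * C) * (1 - r) powr (-1/2)"
    have cmod_r: "cmod (of_real r * \<xi>) = r" if "\<xi> \<in> space circle_measure" for \<xi>
      using that r by (simp add: space_circle_measure norm_mult)
    have hA: "?h \<xi> \<le> A" if "\<xi> \<in> space circle_measure" for \<xi>
      using weak_L2_poisson_integral_sup[OF intg C(1) weak, of "of_real r * \<xi>"] cmod_r[OF that] r
      by (simp add: A_def)
    have h0: "0 \<le> ?h \<xi>" if "\<xi> \<in> space circle_measure" for \<xi>
      unfolding poisson_integral_def using cmod_r[OF that] r
      by (intro integral_nonneg_AE AE_I2 mult_nonneg_nonneg poisson_nonneg) (auto simp: g_def)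
    have pow1: "1 \<le> (1 - r) powr (-1/2)"
      using r powr_mono2'[of "-1/2" "1 - r" 1] by simp
    have A1: "1 \<le> A"
      unfolding A_def using pow1 C mult_mono[of 1 "1 + 2 * C" 1 "(1 - r) powr (-1/2)"] by simp
    have intf: "integrable circle_measure (\<lambda>\<zeta>. cmod (f (of_real r * \<zeta>)))"
      by (intro continuous_on_integrable_circle continuous_intros
            continuous_on_subset[OF continuous_on_dilation(1)[OF hol r]]) auto
    have "ennreal (\<integral>\<zeta>. cmod (f (of_real r * \<zeta>)) \<partial>circle_measure)
        = (\<integral>\<^sup>+\<zeta>. ennreal (cmod (f (of_real r * \<zeta>))) \<partial>circle_measure)"
      using intf by (intro nn_integral_eq_integral[symmetric]) auto
    also have "\<dots> \<le> (\<integral>\<^sup>+\<zeta>. ennreal (?h \<zeta> powr a) \<partial>circle_measure)"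
      using r by (intro nn_integral_mono ennreal_leI f_le) (simp add: cmod_r)
    also have "\<dots> \<le> ennreal (measure circle_measure (space circle_measure) + a * (4 * C) / (a - 2) * A powr (a - 2))"
      using weak_L2_poisson_integral[OF intg C(1) weak r]
      by (intro circle.weak_L2_powr_bound hm A1 a h0 hA) (use C in auto)
    also have "\<dots> \<le> ennreal (K * (1 - r) powr (1 - 1/p))"
    proof (rule ennreal_leI)
      have "(a - 2) * (-1/2) = 1 - 1/p" using p by (simp add: a_def field_simps)
      hence "A powr (a - 2) = (1 + 2 * C) powr (a - 2) * (1 - r) powr (1 - 1/p)"
        unfolding A_def using C r by (subst powr_mult) (auto simp: powr_powr mult.commute)
      moreover have "1 \<le> A powr (a - 2)" using A1 a by (simp add: ge_one_powr_ge_zero)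
      ultimately show "measure circle_measure (space circle_measure) + a * (4 * C) / (a - 2) * A powr (a - 2)
          \<le> K * (1 - r) powr (1 - 1/p)"
        by (simp add: K_def circle.prob_space algebra_simps)
    qed
    finally show ?thesis using K by (subst (asm) ennreal_le_iff) auto
  qed
  thus ?thesis using K by blast
qed

lemma norm_taylor_coefficient_le_mean:
  assumes a: "\<forall>z\<in>ball 0 1. (\<lambda>n. a n * z ^ n) sums f z" and hol: "f holomorphic_on ball 0 1"
    and r: "0 < r" "r < 1"
  shows "cmod (a n) * r ^ n \<le> (\<integral>\<zeta>. cmod (f (of_real r * \<zeta>)) \<partial>circle_measure)"
proof -
  let ?k = "\<lambda>\<zeta>. f (of_real r * \<zeta>)"
  note k = continuous_on_dilation[OF hol r]
  have in_ball: "of_real r * z \<in> ball 0 1" if "z \<in> ball 0 1" for z :: complex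
    using that r mult_strict_mono[of r 1 "cmod z" 1] by (simp add: norm_mult)
  have "eventually (\<lambda>z. z \<in> ball 0 1) (nhds (0::complex))"
    by (intro eventually_nhds_in_open) auto
  hence "eventually (\<lambda>z. (\<lambda>n. fps_nth (Abs_fps (\<lambda>n. a n * of_real r ^ n)) n * z ^ n) sums ?k z) (nhds 0)"
  proof eventually_elim
    case (elim z)
    from a in_ball[OF elim] have "(\<lambda>n. a n * (of_real r * z) ^ n) sums ?k z" by blast
    thus ?case by (simp add: power_mult_distrib mult_ac)
  qed
  hence "?k has_fps_expansion Abs_fps (\<lambda>n. a n * of_real r ^ n)"
    by (rule has_fps_expansionI)
  from fps_nth_fps_expansion[OF this, of n]
  have coeff: "(deriv ^^ n) ?k 0 / fact n = a n * of_real r ^ n" by simp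
  have "((\<lambda>u. ?k u / (u - 0) ^ Suc n) has_contour_integral (2 * pi * \<i>) / fact n * (deriv ^^ n) ?k 0) (circlepath 0 1)"
    by (rule Cauchy_has_contour_integral_higher_derivative_circlepath[OF k]) simp
  hence cint: "contour_integral (circlepath 0 1) (\<lambda>u. ?k u / u ^ Suc n) = (2 * pi * \<i>) * (a n * of_real r ^ n)"
    by (subst coeff[symmetric]) (simp add: contour_integral_unique)
  have cont: "continuous_on (sphere 0 1) (\<lambda>\<zeta>. ?k \<zeta> / \<zeta> ^ n)"
    using continuous_on_subset[OF k(1), of "sphere 0 1"] by (intro continuous_intros) auto
  have "(\<integral>\<zeta>. ?k \<zeta> / \<zeta> ^ n \<partial>circle_measure) = a n * of_real r ^ n"
    by (subst integral_circle_eq_contour_integral[OF cont]) (use cint in \<open>simp add: mult.commute\<close>)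
  hence "cmod (a n) * r ^ n = cmod (\<integral>\<zeta>. ?k \<zeta> / \<zeta> ^ n \<partial>circle_measure)"
    using r by (simp add: norm_mult norm_power)
  also have "\<dots> \<le> (\<integral>\<zeta>. cmod (?k \<zeta> / \<zeta> ^ n) \<partial>circle_measure)"
    by (rule integral_norm_bound)
  also have "\<dots> = (\<integral>\<zeta>. cmod (?k \<zeta>) \<partial>circle_measure)"
    by (intro Bochner_Integration.integral_cong) (auto simp: space_circle_measure norm_divide norm_power)
  finally show ?thesis .
qed

lemma weak_hardy_coefficient_bound:
  assumes p: "0 < p" "p < 1" and f: "f \<in> weak_hardy p"
    and a: "\<forall>z\<in>ball 0 1. (\<lambda>n. a n * z ^ n) sums f z"
  shows "\<exists>K. \<forall>n. cmod (a n) \<le> K * weight (1/p - 1) n"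
proof -
  define \<beta> where "\<beta> = 1/p - 1"
  have \<beta>: "\<beta> > 0" using p by (simp add: \<beta>_def)
  obtain K where K: "K \<ge> 0" "\<And>r. 0 < r \<Longrightarrow> r < 1 \<Longrightarrow>
      (\<integral>\<zeta>. cmod (f (of_real r * \<zeta>)) \<partial>circle_measure) \<le> K * (1 - r) powr (1 - 1/p)"
    using weak_hardy_mean_bound[OF p f] by blast
  have hol: "f holomorphic_on ball 0 1"
    using f by (auto simp: weak_hardy_def smirnov_class_def nevanlinna_class_def)
  have bound: "cmod (a n) \<le> exp 1 * K * 2 powr \<beta> * weight \<beta> n" if n: "n \<ge> 1" for n
  proof -
    \<comment> \<open>At this radius \<open>r ^ n\<close> stays above \<open>exp (-1)\<close>.\<close>
    define r where "r = real n / (real n + 1)"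
    have r: "0 < r" "r < 1" "1 - r = 1 / (real n + 1)" using n by (auto simp: r_def field_simps)
    have "cmod (a n) * r ^ n \<le> K * (1 - r) powr (1 - 1/p)"
      using norm_taylor_coefficient_le_mean[OF a hol r(1,2), of n] K(2)[OF r(1,2)] by linarith
    also have "(1 - r) powr (1 - 1/p) = (real n + 1) powr \<beta>"
      unfolding r(3) \<beta>_def using n by (simp add: powr_divide powr_minus_divide[symmetric] minus_diff_eq)
    also have "(real n + 1) powr \<beta> \<le> (2 * real n) powr \<beta>"
      using n \<beta> by (intro powr_mono2) auto
    also have "\<dots> = 2 powr \<beta> * weight \<beta> n" using n by (simp add: weight_def powr_mult)
    finally have 1: "cmod (a n) * r ^ n \<le> K * (2 powr \<beta> * weight \<beta> n)" using K(1) by (simp add: mult_left_mono)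
    have "inverse r = 1 + 1 / real n" using n by (simp add: r_def field_simps)
    also have "\<dots> \<le> exp (1 / real n)" by (rule exp_ge_add_one_self)
    finally have "inverse r ^ n \<le> exp (1 / real n) ^ n" using r by (intro power_mono) auto
    also have "\<dots> = exp 1" using n by (simp add: exp_of_nat_mult[symmetric])
    finally have 2: "inverse r ^ n \<le> exp 1" .
    have "cmod (a n) = (cmod (a n) * r ^ n) * inverse r ^ n"
      using r by (simp add: power_inverse)
    also have "\<dots> \<le> (K * (2 powr \<beta> * weight \<beta> n)) * exp 1"
      using r K(1) by (intro mult_mono[OF 1 2]) (auto simp: weight_def)
    finally show ?thesis by (simp add: mult_ac)
  qed
  define L where "L = max (cmod (a 0)) (exp 1 * K * 2 powr \<beta>)"
  have "cmod (a n) \<le> L * weight \<beta> n" for n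
  proof (cases "n = 0")
    case True
    thus ?thesis by (simp add: L_def weight_def)
  next
    case False
    have "exp 1 * K * 2 powr \<beta> * weight \<beta> n \<le> L * weight \<beta> n"
      by (intro mult_right_mono) (auto simp: L_def weight_def)
    thus ?thesis using bound[of n] False by linarith
  qed
  thus ?thesis unfolding \<beta>_def by blast
qed

section \<open>The extremal function\<close>

text \<open>For \<open>\<epsilon> < 1\<close>, the Poisson kernel of the point \<open>1 - \<epsilon>\<close> has integral 1 and is at least \<open>1 / (4 * \<epsilon>)\<close> on the cap,
  which bounds the measure of the cap.\<close>

lemma circle_cap_measure:
  assumes \<epsilon>: "\<epsilon> > 0"
  shows "measure circle_measure {\<zeta> \<in> space circle_measure. cmod (1 - \<zeta>) < \<epsilon>} \<le> 4 * \<epsilon>"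
proof (cases "\<epsilon> \<ge> 1")
  case True
  thus ?thesis using circle.prob_le_1[of "{\<zeta> \<in> space circle_measure. cmod (1 - \<zeta>) < \<epsilon>}"] by linarith
next
  case False
  let ?z = "complex_of_real (1 - \<epsilon>)"
  have cz: "cmod ?z = 1 - \<epsilon>" using False by (subst norm_of_real) simp
  hence z: "cmod ?z < 1" using \<epsilon> by simp
  have "measure circle_measure {\<zeta> \<in> space circle_measure. cmod (1 - \<zeta>) < \<epsilon>}
      \<le> measure circle_measure {\<zeta> \<in> space circle_measure. poisson ?z \<zeta> \<ge> 1 / (4 * \<epsilon>)}"
  proof (intro circle.finite_measure_mono subsetI)
    fix \<zeta> assume "\<zeta> \<in> {\<zeta> \<in> space circle_measure. cmod (1 - \<zeta>) < \<epsilon>}"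
    hence \<zeta>: "\<zeta> \<in> space circle_measure" "cmod \<zeta> = 1" "cmod (1 - \<zeta>) < \<epsilon>"
      by (auto simp: space_circle_measure)
    have "cmod (\<zeta> - ?z) \<le> cmod (1 - \<zeta>) + \<epsilon>"
      using norm_triangle_ineq4[of "of_real \<epsilon>" "1 - \<zeta>"] \<epsilon> by (simp add: algebra_simps)
    hence up: "(cmod (\<zeta> - ?z))\<^sup>2 \<le> (2 * \<epsilon>)\<^sup>2" using \<zeta> by (intro power_mono) auto
    have "\<zeta> \<noteq> ?z" using \<zeta>(2) z by auto
    hence pos: "(cmod (\<zeta> - ?z))\<^sup>2 > 0" by simp
    have "\<epsilon> * \<epsilon> \<le> \<epsilon> * 1" using False \<epsilon> by (intro mult_left_mono) auto
    hence low: "\<epsilon> \<le> 1 - (cmod ?z)\<^sup>2" unfolding cz by (simp add: power2_eq_square algebra_simps)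
    have "1 / (4 * \<epsilon>) = \<epsilon> / (2 * \<epsilon>)\<^sup>2" using \<epsilon> by (simp add: power2_eq_square)
    also have "\<dots> \<le> (1 - (cmod ?z)\<^sup>2) / (cmod (\<zeta> - ?z))\<^sup>2"
      using low \<epsilon> by (intro frac_le[OF _ low pos up]) linarith
    finally show "\<zeta> \<in> {\<zeta> \<in> space circle_measure. poisson ?z \<zeta> \<ge> 1 / (4 * \<epsilon>)}"
      using \<zeta> by (simp add: poisson_def)
  qed measurable
  also have "\<dots> \<le> (\<integral>\<zeta>. poisson ?z \<zeta> \<partial>circle_measure) / (1 / (4 * \<epsilon>))"
    using z \<epsilon> poisson_nonneg[OF z]
    by (intro integral_Markov_inequality_measure[where A = "{}"] continuous_on_integrable_circle
          continuous_on_poisson) auto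
  also have "\<dots> = 4 * \<epsilon>" using integral_poisson[OF z] by simp
  finally show ?thesis .
qed

lemma AE_circle_neq_1: "AE \<zeta> in circle_measure. \<zeta> \<noteq> 1"
proof -
  let ?m = "measure circle_measure {1}"
  have one: "{1} \<in> sets circle_measure"
    using borel_sets_circle[of "{1}"] by simp
  have "?m \<le> 0 + e" if "e > 0" for e
  proof -
    have "{1} \<subseteq> {\<zeta> \<in> space circle_measure. cmod (1 - \<zeta>) < e / 4}"
      using that by (auto simp: space_circle_measure)
    hence "?m \<le> measure circle_measure {\<zeta> \<in> space circle_measure. cmod (1 - \<zeta>) < e / 4}"
      by (rule circle.finite_measure_mono) measurable
    also have "\<dots> \<le> 4 * (e / 4)" using that by (intro circle_cap_measure) auto
    finally show ?thesis by simp
  qed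
  hence "?m \<le> 0" by (rule field_le_epsilon)
  hence "emeasure circle_measure {1} = 0" by (simp add: circle.emeasure_eq_measure measure_le_0_iff)
  thus ?thesis using one by (intro AE_I[where N = "{1}"]) auto
qed

text \<open>The singularity is of weak type 2 by the measure of caps. The function serves as an integrable
  majorant of \<open>log\<^sup>+\<close> of the extremal function.\<close>

lemma integrable_circle_root_singularity:
  "integrable circle_measure (\<lambda>\<zeta>. (cmod (1 - \<zeta>) / 2) powr (-1/2))"
proof (rule circle.weak_L2_integrable[where C = 8])
  fix t :: real assume t: "t > 0"
  have "measure circle_measure {\<zeta> \<in> space circle_measure. t < (cmod (1 - \<zeta>) / 2) powr (-1/2)}
      \<le> measure circle_measure {\<zeta> \<in> space circle_measure. cmod (1 - \<zeta>) < 2 / t\<^sup>2}"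
  proof (intro circle.finite_measure_mono subsetI)
    fix \<zeta> assume \<zeta>: "\<zeta> \<in> {\<zeta> \<in> space circle_measure. t < (cmod (1 - \<zeta>) / 2) powr (-1/2)}"
    hence "((cmod (1 - \<zeta>) / 2) powr (-1/2)) powr (-2) < t powr (-2)"
      using t by (intro powr_less_mono2_neg) auto
    hence "cmod (1 - \<zeta>) / 2 < t powr (-2)" by (simp add: powr_powr)
    also have "t powr (-2) = 1 / t\<^sup>2" using t by (simp add: powr_minus_divide)
    finally show "\<zeta> \<in> {\<zeta> \<in> space circle_measure. cmod (1 - \<zeta>) < 2 / t\<^sup>2}" using \<zeta> by simp
  qed measurable
  also have "\<dots> \<le> 4 * (2 / t\<^sup>2)" using t by (intro circle_cap_measure) auto
  finally show "measure circle_measure {\<zeta> \<in> space circle_measure. t < (cmod (1 - \<zeta>) / 2) powr (-1/2)} \<le> 8 / t\<^sup>2"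
    by simp
qed auto

lemma one_minus_notin_nonpos_Reals:
  assumes "cmod z \<le> 1" "z \<noteq> 1"
  shows "1 - z \<notin> \<real>\<^sub>\<le>\<^sub>0"
proof
  assume "1 - z \<in> \<real>\<^sub>\<le>\<^sub>0"
  hence "Re z \<ge> 1" "Im z = 0" by (auto simp: complex_nonpos_Reals_iff)
  moreover have "Re z \<le> 1" using complex_Re_le_cmod[of z] assms(1) by linarith
  ultimately show False using assms(2) by (auto simp: complex_eq_iff)
qed

definition binomial_kernel :: "real \<Rightarrow> complex \<Rightarrow> complex" where
  "binomial_kernel b z = (1 - z) powr (- of_real b)"

lemma norm_binomial_kernel: "z \<noteq> 1 \<Longrightarrow> cmod (binomial_kernel b z) = cmod (1 - z) powr (-b)"
  unfolding binomial_kernel_def using norm_powr_real_powr'[of "-of_real b" "1 - z"] by simp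

lemma isCont_binomial_kernel:
  assumes "cmod z \<le> 1" "z \<noteq> 1"
  shows "isCont (binomial_kernel b) z"
  unfolding binomial_kernel_def
  using one_minus_notin_nonpos_Reals[OF assms] by (intro continuous_intros) auto

lemma boundary_function_binomial_kernel:
  assumes "cmod \<zeta> = 1" "\<zeta> \<noteq> 1"
  shows "boundary_function (binomial_kernel b) \<zeta> = binomial_kernel b \<zeta>"
proof (rule boundary_function_eq)
  show "has_nontangential_limit (binomial_kernel b) \<zeta> (binomial_kernel b \<zeta>)"
    unfolding has_nontangential_limit_def
    using isCont_binomial_kernel[of \<zeta> b] assms by (auto simp: isCont_def intro: tendsto_within_subset)
qed (use assms in auto)

text \<open>A majorant that does not depend on the radius: on the way from \<open>\<zeta>\<close> to \<open>r * \<zeta>\<close> the distance to \<open>1\<close>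
  shrinks at most by half, and \<open>- ln x \<le> 2 * x powr (-1/2)\<close>.\<close>

lemma log_plus_binomial_kernel_le:
  assumes b: "b > 0" and \<zeta>: "cmod \<zeta> = 1" "\<zeta> \<noteq> 1" and r: "0 < r" "r < 1"
  shows "log_plus (cmod (binomial_kernel b (of_real r * \<zeta>))) \<le> 2 * b * (cmod (1 - \<zeta>) / 2) powr (-1/2)"
proof -
  let ?w = "of_real r * \<zeta>"
  define x where "x = cmod (1 - \<zeta>) / 2"
  have x: "x > 0" using \<zeta> by (simp add: x_def)
  have cw: "cmod ?w = r" using \<zeta> r by (simp add: norm_mult)
  hence w1: "?w \<noteq> 1" using r by auto
  have "cmod (?w - \<zeta>) = cmod (of_real (r - 1) * \<zeta>)" by (simp add: algebra_simps)
  also have "\<dots> = 1 - r" using \<zeta> r by (simp only: norm_mult norm_of_real) simp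
  also have "\<dots> \<le> cmod (1 - ?w)" using norm_triangle_ineq2[of 1 ?w] cw by simp
  finally have "x \<le> cmod (1 - ?w)"
    using norm_triangle_ineq[of "1 - ?w" "?w - \<zeta>"] by (simp add: x_def)
  hence "ln x \<le> ln (cmod (1 - ?w))" using x by (subst ln_le_cancel_iff) auto
  hence "ln (cmod (binomial_kernel b ?w)) \<le> b * (- ln x)"
    using b w1 by (simp add: norm_binomial_kernel[OF w1] ln_powr)
  also have "- ln x = 2 * ln (x powr (-1/2))" using x by (simp add: ln_powr)
  also have "\<dots> \<le> 2 * x powr (-1/2)"
    using x ln_le_minus_one[of "x powr (-1/2)"] by simp
  finally show ?thesis
    using b by (simp add: log_plus_def x_def mult_left_mono)
qed

lemma binomial_kernel_holomorphic: "binomial_kernel b holomorphic_on ball 0 1"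
  unfolding binomial_kernel_def
  by (intro holomorphic_intros one_minus_notin_nonpos_Reals) auto

text \<open>The integral of the majorant above bounds all the means of \<open>log\<^sup>+\<close>, and dominated convergence
  identifies their limit; nontangential limits exist at every \<open>\<zeta> \<noteq> 1\<close>.\<close>

lemma binomial_kernel_smirnov:
  assumes b: "b > 0"
  shows "binomial_kernel b \<in> smirnov_class"
proof -
  let ?F = "binomial_kernel b"
  define W where "W = (\<lambda>\<zeta>. ennreal (2 * b * (cmod (1 - \<zeta>) / 2) powr (-1/2)))"
  have [measurable]: "W \<in> borel_measurable circle_measure" unfolding W_def by measurable
  have "integrable circle_measure (\<lambda>\<zeta>. 2 * b * (cmod (1 - \<zeta>) / 2) powr (-1/2))"
    by (intro integrable_mult_right integrable_circle_root_singularity)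
  from nn_integral_eq_integral[OF this]
  have W_fin: "(\<integral>\<^sup>+\<zeta>. W \<zeta> \<partial>circle_measure) < \<infinity>" using b by (simp add: W_def)
  have AE_ne: "AE \<zeta> in circle_measure. cmod \<zeta> = 1 \<and> \<zeta> \<noteq> 1"
    using AE_circle_neq_1 by (rule AE_mp) (auto simp: space_circle_measure)
  have le_W: "AE \<zeta> in circle_measure. ennreal (log_plus (cmod (?F (of_real r * \<zeta>)))) \<le> W \<zeta>"
    if "0 < r" "r < 1" for r
    using AE_ne by eventually_elim (use that log_plus_binomial_kernel_le[OF b] in \<open>auto simp: W_def intro!: ennreal_leI\<close>)
  note [measurable] = boundary_function_measurable[OF binomial_kernel_holomorphic]
  have "(SUP r\<in>{0<..<1}. \<integral>\<^sup>+ \<zeta>. ennreal (log_plus (cmod (?F (of_real r * \<zeta>)))) \<partial>circle_measure)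
      \<le> (\<integral>\<^sup>+\<zeta>. W \<zeta> \<partial>circle_measure)"
    by (intro SUP_least nn_integral_mono_AE le_W) auto
  also note W_fin
  finally have nev: "?F \<in> nevanlinna_class"
    using binomial_kernel_holomorphic by (simp add: nevanlinna_class_def)
  have "((\<lambda>r. \<integral>\<^sup>+ \<zeta>. ennreal (log_plus (cmod (?F (of_real r * \<zeta>)))) \<partial>circle_measure)
        \<longlongrightarrow> (\<integral>\<^sup>+ \<zeta>. ennreal (log_plus (cmod (boundary_function ?F \<zeta>))) \<partial>circle_measure)) (at_left 1)"
  proof (rule tendsto_at_left_sequentially[of 0])
    fix S :: "nat \<Rightarrow> real"
    assume S: "\<And>n. S n < 1" "\<And>n. 0 < S n" "S \<longlonglongrightarrow> 1"
    show "(\<lambda>n. \<integral>\<^sup>+ \<zeta>. ennreal (log_plus (cmod (?F (of_real (S n) * \<zeta>)))) \<partial>circle_measure)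
        \<longlonglongrightarrow> (\<integral>\<^sup>+ \<zeta>. ennreal (log_plus (cmod (boundary_function ?F \<zeta>))) \<partial>circle_measure)"
    proof (rule nn_integral_dominated_convergence[where w = W])
      fix n
      have "(\<lambda>\<zeta>. ?F (of_real (S n) * \<zeta>)) \<in> borel_measurable circle_measure"
        using continuous_on_dilation(1)[OF binomial_kernel_holomorphic S(2) S(1), of b n]
        by (intro continuous_on_measurable_circle) (rule continuous_on_subset, auto)
      thus "(\<lambda>\<zeta>. ennreal (log_plus (cmod (?F (of_real (S n) * \<zeta>))))) \<in> borel_measurable circle_measure"
        by measurable
      show "AE \<zeta> in circle_measure. ennreal (log_plus (cmod (?F (of_real (S n) * \<zeta>)))) \<le> W \<zeta>"
        by (rule le_W) (use S in auto)
    next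
      show "AE \<zeta> in circle_measure. (\<lambda>n. ennreal (log_plus (cmod (?F (of_real (S n) * \<zeta>)))))
          \<longlonglongrightarrow> ennreal (log_plus (cmod (boundary_function ?F \<zeta>)))"
        using AE_ne
      proof eventually_elim
        case (elim \<zeta>)
        have "(\<lambda>n. of_real (S n) * \<zeta>) \<longlonglongrightarrow> of_real 1 * \<zeta>" by (intro tendsto_intros S)
        hence "(\<lambda>n. ?F (of_real (S n) * \<zeta>)) \<longlonglongrightarrow> ?F \<zeta>"
          using isCont_binomial_kernel[of \<zeta> b] elim by (intro isCont_tendsto_compose[where g = ?F]) auto
        thus ?case
          using elim unfolding log_plus_eq[OF norm_ge_zero]
          by (simp add: boundary_function_binomial_kernel) (intro tendsto_intros, auto)
      qed
    qed (use W_fin in measurable)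
  qed simp
  thus ?thesis using nev by (simp add: smirnov_class_def)
qed

lemma binomial_kernel_weak_hardy:
  assumes p: "p > 0"
  shows "binomial_kernel (1/p) \<in> weak_hardy p"
proof -
  let ?g = "boundary_function (binomial_kernel (1/p))"
  have "decreasing_rearrangement ?g s * s powr (1/p) \<le> 4 powr (1/p)" if s: "s > 0" for s
  proof -
    define t where "t = (4 / s) powr (1/p)"
    have "distribution_function ?g t \<le> measure circle_measure {\<zeta> \<in> space circle_measure. cmod (1 - \<zeta>) < s / 4}"
      unfolding distribution_function_def space_circle_measure[symmetric]
    proof (intro circle.finite_measure_mono subsetI)
      fix \<zeta> assume \<zeta>: "\<zeta> \<in> {\<zeta> \<in> space circle_measure. t < cmod (?g \<zeta>)}"
      show "\<zeta> \<in> {\<zeta> \<in> space circle_measure. cmod (1 - \<zeta>) < s / 4}"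
      proof (cases "\<zeta> = 1")
        case False
        have "cmod \<zeta> = 1" "t < cmod (?g \<zeta>)" using \<zeta> by (auto simp: space_circle_measure)
        hence "t < cmod (1 - \<zeta>) powr (-(1/p))"
          using boundary_function_binomial_kernel[OF _ False] norm_binomial_kernel[OF False] by simp
        hence "(cmod (1 - \<zeta>) powr (-(1/p))) powr (-p) < t powr (-p)"
          using p s by (intro powr_less_mono2_neg) (auto simp: t_def)
        also have "t powr (-p) = s / 4" using p s by (simp add: t_def powr_powr powr_minus_divide)
        finally show ?thesis using p \<zeta> by (simp add: powr_powr)
      qed (use \<zeta> s in simp)
    qed measurable
    also have "\<dots> \<le> 4 * (s / 4)" using s by (intro circle_cap_measure) auto
    finally have "distribution_function ?g t \<le> s" by simp
    hence "decreasing_rearrangement ?g s \<le> t"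
      unfolding decreasing_rearrangement_def
      by (intro cInf_lower) (auto simp: t_def intro!: bdd_belowI[of _ 0])
    hence "decreasing_rearrangement ?g s * s powr (1/p) \<le> t * s powr (1/p)"
      by (intro mult_right_mono) auto
    also have "\<dots> = 4 powr (1/p)" using s by (simp add: t_def powr_mult[symmetric])
    finally show ?thesis .
  qed
  hence "bdd_above ((\<lambda>s. decreasing_rearrangement ?g s * s powr (1/p)) ` {0<..})"
    by (intro bdd_aboveI2) auto
  thus ?thesis using p binomial_kernel_smirnov[of "1/p"] by (simp add: weak_hardy_def)
qed

lemma binomial_kernel_sums:
  assumes "cmod z < 1"
  shows "(\<lambda>n. of_real (pochhammer b n / fact n) * z ^ n) sums binomial_kernel b z"
proof -
  have "(\<lambda>n. ((- of_real b) gchoose n) * (- z) ^ n) sums (1 + (- z)) powr (- of_real b)"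
    using assms by (intro gen_binomial_complex) simp
  moreover have "((- of_real b) gchoose n) * (- z) ^ n = of_real (pochhammer b n / fact n) * z ^ n" for n
  proof -
    have "(- z) ^ n = (-1) ^ n * z ^ n" by (rule power_minus)
    moreover have "(-1) ^ n * (-1) ^ n = (1::complex)" by (simp flip: power_mult_distrib)
    ultimately show ?thesis
      by (simp add: gbinomial_pochhammer pochhammer_of_real)
  qed
  ultimately show ?thesis by (simp add: binomial_kernel_def)
qed

text \<open>The coefficients are asymptotic to \<open>n powr (b - 1) / Gamma b\<close> by Gauss's limit formula for the Gamma
  function, so their quotients with the weights are bounded.\<close>

lemma weight_le_binomial_coefficient:
  assumes b: "b > 0"
  shows "\<exists>K. \<forall>n. weight (b - 1) n \<le> K * (pochhammer b n / fact n)"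
proof -
  have poch: "pochhammer b n > 0" for n using b by (rule pochhammer_pos)
  define q where "q = (\<lambda>n. Gamma_series b n * ((b + real n) / real n))"
  have "q \<longlonglongrightarrow> Gamma b * 1"
    unfolding q_def by (intro tendsto_mult Gamma_series_LIMSEQ) real_asymp
  hence "Bseq q" by (intro convergent_imp_Bseq convergentI)
  then obtain K0 where K0: "\<And>n. \<bar>q n\<bar> \<le> K0" by (auto simp: Bseq_def)
  have "weight (b - 1) n \<le> max 1 K0 * (pochhammer b n / fact n)" for n
  proof (cases "n = 0")
    case False
    have "q n * (pochhammer b n / fact n) = exp (b * ln (real n)) / real n"
      using False b poch[of n]
      by (simp add: q_def Gamma_series_def pochhammer_Suc divide_simps)
    also have "\<dots> = real n powr (b - 1)" using False by (subst powr_diff) (simp add: powr_def)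
    finally have "weight (b - 1) n = q n * (pochhammer b n / fact n)" using False by (simp add: weight_def)
    also have "\<dots> \<le> max 1 K0 * (pochhammer b n / fact n)"
      using K0[of n] poch[of n] by (intro mult_right_mono) auto
    finally show ?thesis .
  qed (simp add: weight_def)
  thus ?thesis by blast
qed

section \<open>Multipliers\<close>

lemma ell_dominated:
  assumes y: "y \<in> ell s" and le: "\<And>n. cmod (x n) \<le> K * cmod (y n)"
  shows "x \<in> ell s"
proof (cases "s = \<infinity>")
  case True
  then obtain B where B: "\<And>n. cmod (y n) \<le> B" using y by (auto simp: ell_def bounded_iff)
  have "cmod (x n) \<le> \<bar>K\<bar> * B" for n
  proof -
    have "cmod (x n) \<le> \<bar>K\<bar> * cmod (y n)" using le[of n] by (rule order_trans) (simp add: mult_right_mono)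
    also have "\<dots> \<le> \<bar>K\<bar> * B" using B by (simp add: mult_left_mono)
    finally show ?thesis .
  qed
  thus ?thesis using True by (auto simp: ell_def bounded_iff)
next
  case False
  define \<sigma> where "\<sigma> = enn2real s"
  have \<sigma>: "\<sigma> \<ge> 0" by (simp add: \<sigma>_def)
  have "summable (\<lambda>n. \<bar>K\<bar> powr \<sigma> * cmod (y n) powr \<sigma>)"
    using y False by (intro summable_mult) (simp add: ell_def \<sigma>_def)
  moreover have "norm (cmod (x n) powr \<sigma>) \<le> \<bar>K\<bar> powr \<sigma> * cmod (y n) powr \<sigma>" for n
  proof -
    have "cmod (x n) \<le> \<bar>K\<bar> * cmod (y n)" using le[of n] by (rule order_trans) (simp add: mult_right_mono)
    hence "cmod (x n) powr \<sigma> \<le> (\<bar>K\<bar> * cmod (y n)) powr \<sigma>" using \<sigma> by (intro powr_mono2) auto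
    thus ?thesis by (simp add: powr_mult)
  qed
  ultimately have "summable (\<lambda>n. cmod (x n) powr \<sigma>)" by (rule summable_comparison_test'[where N = 0])
  thus ?thesis using False by (simp add: ell_def \<sigma>_def)
qed

theorem corollary5p1:
  fixes p :: real and s :: ennreal
  assumes "0 < p" and "p < 1" and "0 < s"
  shows "multipliers (taylor_sequences (weak_hardy p)) (ell s) = weighted (ell s) (1 / p - 1)"
proof (intro equalityI subsetI)
  fix l assume "l \<in> weighted (ell s) (1/p - 1)"
  hence l: "(\<lambda>n. of_real (weight (1/p - 1) n) * l n) \<in> ell s" by (simp add: weighted_def)
  show "l \<in> multipliers (taylor_sequences (weak_hardy p)) (ell s)"
    unfolding multipliers_def
  proof (intro CollectI ballI)
    fix a assume "a \<in> taylor_sequences (weak_hardy p)"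
    then obtain f where "f \<in> weak_hardy p" "\<forall>z\<in>ball 0 1. (\<lambda>n. a n * z ^ n) sums f z"
      by (auto simp: taylor_sequences_def)
    from weak_hardy_coefficient_bound[OF assms(1,2) this]
    obtain K where K: "\<And>n. cmod (a n) \<le> K * weight (1/p - 1) n" by blast
    show "(\<lambda>n. l n * a n) \<in> ell s"
    proof (rule ell_dominated[OF l])
      fix n
      have "cmod (l n * a n) \<le> cmod (l n) * (K * weight (1/p - 1) n)"
        unfolding norm_mult by (intro mult_left_mono K) auto
      thus "cmod (l n * a n) \<le> K * cmod (of_real (weight (1/p - 1) n) * l n)"
        by (simp add: norm_mult weight_def mult_ac)
    qed
  qed
next
  fix l assume l: "l \<in> multipliers (taylor_sequences (weak_hardy p)) (ell s)"
  define c where "c = (\<lambda>n. pochhammer (1/p) n / fact n :: real)"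
  have c: "c n \<ge> 0" for n
    unfolding c_def using assms(1) by (intro divide_nonneg_pos less_imp_le[OF pochhammer_pos]) auto
  have "(\<lambda>n. complex_of_real (c n)) \<in> taylor_sequences (weak_hardy p)"
    unfolding taylor_sequences_def c_def
    by (intro CollectI bexI[of _ "binomial_kernel (1/p)"] ballI binomial_kernel_sums
          binomial_kernel_weak_hardy assms(1)) simp
  hence lc: "(\<lambda>n. l n * complex_of_real (c n)) \<in> ell s" using l by (simp add: multipliers_def)
  obtain K where K: "\<And>n. weight (1/p - 1) n \<le> K * c n"
    using weight_le_binomial_coefficient[of "1/p"] assms(1) unfolding c_def by auto
  have "(\<lambda>n. of_real (weight (1/p - 1) n) * l n) \<in> ell s"
  proof (rule ell_dominated[OF lc])
    fix n
    have "cmod (of_real (weight (1/p - 1) n) * l n) = weight (1/p - 1) n * cmod (l n)"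
      by (simp add: norm_mult weight_def)
    also have "\<dots> \<le> (K * c n) * cmod (l n)" by (intro mult_right_mono K) auto
    also have "\<dots> = K * cmod (l n * of_real (c n))" using c[of n] by (simp add: norm_mult)
    finally show "cmod (of_real (weight (1/p - 1) n) * l n) \<le> K * cmod (l n * of_real (c n))" .
  qed
  thus "l \<in> weighted (ell s) (1/p - 1)" by (simp add: weighted_def)
qed

end
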